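(* Let $m=3000564\ell^{3}+5000940\ell^{2}+2778300\ell+507297$, where $\ell$ is an odd positive integer such that $\ell\not\equiv 1\pmod{7}$. Then $3$ divides $h_{4m}$, the class number of the cyclotomic field $\mathbb{Q}(\zeta_{4m})$.
   Context: For a positive integer $N$, $\zeta_{N}$ denotes a primitive $N$-th root of unity. For an integer $m>1$, $h_{4m}$ denotes the class number (order of the ideal class group of the ring of integers) of the cyclotomic field $\mathbb{Q}(\zeta_{4m})$. *)

theory Defs
  imports Complex_Main "HOL-Algebra.Algebra" "HOL-Algebra.Algebraic_Closure_Type"
    "HOL-Number_Theory.Cong"
begin

definition primitive_root_of_unity :: "nat \<Rightarrow> complex \<Rightarrow> bool" where
  "primitive_root_of_unity n z \<longleftrightarrow>
     n > 0 \<and> z ^ n = 1 \<and> (\<forall>k. 0 < k \<and> k < n \<longrightarrow> z ^ k \<noteq> 1)"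

text \<open>Number fields are represented by their sets of elements inside the complex numbers.
  A generated subfield always contains the rationals, so no base field is mentioned.\<close>

definition rat_adjoin :: "complex \<Rightarrow> complex set" where
  "rat_adjoin z = generate_field ring_of_type_algebra {z}"

definition ring_of_integers :: "complex set \<Rightarrow> complex ring" where
  "ring_of_integers K = ring_of_type_algebra\<lparr>carrier := {x \<in> K. algebraic_int x}\<rparr>"

text \<open>A nonzero fractional ideal is a set $d^{-1} I$ with $I$ a nonzero ideal of the ring of
  integers and $d$ a nonzero integer of the field. The product of two fractional ideals is the
  set of finite sums of products of their elements; such products need not be integral,
  which is why the library's ideal product is taken in the ambient ring of complex numbers.\<close>

definition fractional_ideals :: "complex set \<Rightarrow> complex set set" where
  "fractional_ideals K =
     {(\<lambda>x. x / d) ` I | I d. ideal I (ring_of_integers K) \<and> I \<noteq> {0} \<and>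
        d \<in> carrier (ring_of_integers K) \<and> d \<noteq> 0}"

definition fractional_ideal_group :: "complex set \<Rightarrow> complex set monoid" where
  "fractional_ideal_group K =
     \<lparr>carrier = fractional_ideals K,
      monoid.mult = ideal_prod ring_of_type_algebra,
      one = carrier (ring_of_integers K)\<rparr>"

definition principal_fractional_ideals :: "complex set \<Rightarrow> complex set set" where
  "principal_fractional_ideals K =
     {(\<lambda>x. a * x) ` carrier (ring_of_integers K) | a. a \<in> K \<and> a \<noteq> 0}"

definition ideal_class_group :: "complex set \<Rightarrow> complex set set monoid" where
  "ideal_class_group K = fractional_ideal_group K Mod principal_fractional_ideals K"

definition class_number :: "complex set \<Rightarrow> nat" where
  "class_number K = Coset.order (ideal_class_group K)"

end

theory Submission
  imports Defs "Jordan_Normal_Form.Char_Poly" "HOL-Library.FuncSet"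
begin

text \<open>
Put $t = 9 l + 5$, so that $m = 3 \cdot 7^3 (4 t^3 - 7)$ and $7$ does not divide $t$. The number
$\theta = (7 - 2 t^3 + \sqrt{49 - 28 t^3}) / 2$ lies in $K = Q(\zeta)$, because $\sqrt m$ and
$\sqrt{-3}$ do, and it has norm $t^6$ and trace prime to $t$ over the rationals. Hence the ideal
$J = (t^2, \theta)$ has cube $(\theta)$. Multiplication by $J$ is a permutation of the ideal
classes with third power the identity, so it suffices that it has no fixed point; an infinite
class group has \<^const>\<open>class_number\<close> $0$ and needs no attention.

A fixed point yields $c \in K$ such that $u = c^3 / \theta$ stabilises a fractional ideal. All
conjugates of $w = u / \bar u$ have absolute value $1$ and the powers of $w$ have bounded
denominators, so $w$ is a root of unity. It follows that $\gamma = \theta / t^3$, which has absolute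
value $1$, has a cube root in some cyclotomic field. Since $\sqrt m$ is irrational, some automorphism
of that field fixes $\gamma$ but inverts $e^{2 \pi i / 3}$, hence fixes exactly one cube root
$\delta$ of $\gamma$. As the Galois group is commutative, all its elements preserve
$\{\delta, \bar\delta\}$, so $\delta + \bar\delta$ is rational. Then $y = t (\delta + \bar\delta)$
is an integer with $(y - t)^2 (y + 2 t) = 7$, which forces $t = 2$.
\<close>

subsection \<open>Sums and products of algebraic integers\<close>

text \<open>The additive group generated by \<open>B\<close> when \<open>B\<close> is finite; over
  an infinite set the sum is 0 by convention.\<close>

definition int_span :: "complex set \<Rightarrow> complex set" where
  "int_span B = {\<Sum>b\<in>B. of_int (c b) * b | c. True}"

text \<open>The nonzero vector \<open>v\<close> is an eigenvector of the integer matrix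
  \<open>A\<close>, so \<open>z\<close> is a root of the characteristic polynomial, which is monic
  with integer coefficients.\<close>

lemma algebraic_int_eigenvalue:
  fixes v :: "nat \<Rightarrow> complex" and A :: "nat \<Rightarrow> nat \<Rightarrow> int"
  assumes "i < n" "v i \<noteq> 0"
    and eig: "\<And>i. i < n \<Longrightarrow> z * v i = (\<Sum>j<n. of_int (A i j) * v j)"
  shows "algebraic_int z"
proof -
  define M where "M = Matrix.mat n n (\<lambda>(i, j). A i j)"
  define M' :: "complex mat" where "M' = map_mat of_int M"
  have M: "M \<in> carrier_mat n n"
    unfolding M_def by (rule mat_carrier)
  have M': "M' \<in> carrier_mat n n"
    unfolding M'_def using M by (rule map_carrier_mat[THEN iffD2])
  have "eigenvector M' (Matrix.vec n v) z"
    unfolding eigenvector_def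
  proof (intro conjI)
    show "Matrix.vec n v \<noteq> 0\<^sub>v (dim_row M')"
      using assms(1,2) M' by (auto simp: vec_eq_iff)
    show "M' *\<^sub>v Matrix.vec n v = z \<cdot>\<^sub>v Matrix.vec n v"
      by (rule eq_vecI)
        (auto simp: M'_def M_def scalar_prod_def eig lessThan_atLeast0 intro!: sum.cong)
  qed (use M' in auto)
  hence "poly (char_poly M') z = 0"
    using eigenvalue_root_char_poly[OF M'] by (auto simp: eigenvalue_def)
  moreover have "char_poly M' = map_poly of_int (char_poly M)"
    unfolding M'_def by (rule of_int_hom.char_poly_hom[OF M])
  moreover have "Polynomial.lead_coeff (char_poly M) = 1"
    using degree_monic_char_poly[OF M] by auto
  ultimately show ?thesis
    by (auto simp: algebraic_int_altdef_ipoly)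
qed

text \<open>Determinant trick: an enumeration of \<open>B\<close>, read as a vector, is an
  eigenvector of an integer matrix for \<open>z\<close>, and \<open>b\<close> makes that vector
  nonzero.\<close>

lemma int_span_mult_imp_algebraic_int:
  assumes "finite B" "b \<in> B" "b \<noteq> 0"
    and closed: "\<And>b. b \<in> B \<Longrightarrow> z * b \<in> int_span B"
  shows "algebraic_int z"
proof -
  define n where "n = card B"
  obtain v where v: "bij_betw v {..<n} B"
    using ex_bij_betw_nat_finite[OF assms(1)] by (auto simp: n_def atLeast0LessThan)
  have "\<forall>b\<in>B. \<exists>c. z * b = (\<Sum>b'\<in>B. of_int (c b') * b')"
    using closed by (auto simp: int_span_def)
  then obtain c where c: "\<And>b. b \<in> B \<Longrightarrow> z * b = (\<Sum>b'\<in>B. of_int (c b b') * b')"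
    by metis
  obtain i where i: "i < n" "v i = b"
    using v assms(2) by (auto simp: bij_betw_def)
  show ?thesis
  proof (rule algebraic_int_eigenvalue[where v = v and A = "\<lambda>i j. c (v i) (v j)"])
    show "i < n" "v i \<noteq> 0" using i assms(3) by auto
    fix i assume "i < n"
    hence "v i \<in> B" using v by (auto simp: bij_betw_def)
    thus "z * v i = (\<Sum>j<n. of_int (c (v i) (v j)) * v j)"
      using c sum.reindex_bij_betw[OF v, of "\<lambda>b'. of_int (c (v i) b') * b'"] by simp
  qed
qed

lemma int_span_add: "x \<in> int_span B \<Longrightarrow> y \<in> int_span B \<Longrightarrow> x + y \<in> int_span B"
proof -
  assume "x \<in> int_span B" "y \<in> int_span B"
  then obtain c d where "x = (\<Sum>b\<in>B. of_int (c b) * b)" "y = (\<Sum>b\<in>B. of_int (d b) * b)"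
    by (auto simp: int_span_def)
  hence "x + y = (\<Sum>b\<in>B. of_int (c b + d b) * b)"
    by (simp add: sum.distrib algebra_simps)
  thus ?thesis unfolding int_span_def by (intro CollectI exI[of _ "\<lambda>b. c b + d b"]) simp
qed

lemma int_span_of_int_mult: "x \<in> int_span B \<Longrightarrow> of_int k * x \<in> int_span B"
proof -
  assume "x \<in> int_span B"
  then obtain c where "x = (\<Sum>b\<in>B. of_int (c b) * b)"
    by (auto simp: int_span_def)
  hence "of_int k * x = (\<Sum>b\<in>B. of_int (k * c b) * b)"
    by (simp add: sum_distrib_left algebra_simps)
  thus ?thesis unfolding int_span_def by (intro CollectI exI[of _ "\<lambda>b. k * c b"]) simp
qed

lemma int_span_0: "0 \<in> int_span B"
  unfolding int_span_def by (intro CollectI exI[of _ "\<lambda>_. 0"]) simp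

lemma int_span_sum: "(\<And>i. i \<in> A \<Longrightarrow> f i \<in> int_span B) \<Longrightarrow> sum f A \<in> int_span B"
  by (induction A rule: infinite_finite_induct) (auto intro: int_span_add int_span_0)

lemma int_span_base: "finite B \<Longrightarrow> b \<in> B \<Longrightarrow> b \<in> int_span B"
  unfolding int_span_def
  by (intro CollectI exI[of _ "\<lambda>b'. if b' = b then 1 else 0"])
    (simp add: if_distrib[of of_int] if_distrib[of "\<lambda>x. x * _"] cong: if_cong)

lemma int_span_mult_closed:
  assumes "\<And>b. b \<in> B \<Longrightarrow> z * b \<in> int_span B" "x \<in> int_span B"
  shows "z * x \<in> int_span B"
proof -
  obtain c where "x = (\<Sum>b\<in>B. of_int (c b) * b)"
    using assms(2) by (auto simp: int_span_def)
  hence "z * x = (\<Sum>b\<in>B. of_int (c b) * (z * b))"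
    by (simp add: sum_distrib_left algebra_simps)
  thus ?thesis using assms(1) by (auto intro!: int_span_sum int_span_of_int_mult)
qed

lemma algebraic_int_power_reduce:
  fixes x :: complex
  assumes "algebraic_int x"
  obtains n c where "n > 0" "x ^ n = (\<Sum>i<n. of_int (c i) * x ^ i)"
proof -
  obtain p where p: "poly (map_poly of_int p) x = 0" "Polynomial.lead_coeff p = 1"
    using assms by (auto simp: algebraic_int_altdef_ipoly)
  define n where "n = Polynomial.degree p"
  have eq: "x ^ n = (\<Sum>i<n. of_int (- Polynomial.coeff p i) * x ^ i)"
  proof -
    have "0 = (\<Sum>i\<le>n. of_int (Polynomial.coeff p i) * x ^ i)"
      using p(1) by (simp add: poly_altdef n_def coeff_map_poly degree_map_poly)
    also have "\<dots> = (\<Sum>i<n. of_int (Polynomial.coeff p i) * x ^ i) + x ^ n"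
      using p(2) by (simp add: n_def lessThan_Suc_atMost[symmetric])
    finally show ?thesis by (simp add: sum_negf add_eq_0_iff)
  qed
  have "n > 0"
  proof (rule ccontr)
    \<comment> \<open>For n = 0 the relation would read 1 = 0.\<close>
    assume "\<not> n > 0"
    thus False using eq by simp
  qed
  thus ?thesis using eq by (rule that)
qed

text \<open>The monomials x^i y^j with i < m and j < n suffice, since x^m and y^n are integer
  combinations of lower powers. The sum and the product of x and y then stabilise the same span, and
  1 is its nonzero element.\<close>

lemma algebraic_int_common_span:
  fixes x y :: complex
  assumes "algebraic_int x" "algebraic_int y"
  obtains B where "finite B" "1 \<in> B" "\<And>b. b \<in> B \<Longrightarrow> x * b \<in> int_span B"
    "\<And>b. b \<in> B \<Longrightarrow> y * b \<in> int_span B"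
proof -
  obtain m c where m: "m > 0" "x ^ m = (\<Sum>i<m. of_int (c i) * x ^ i)"
    using algebraic_int_power_reduce[OF assms(1)] .
  obtain n d where n: "n > 0" "y ^ n = (\<Sum>i<n. of_int (d i) * y ^ i)"
    using algebraic_int_power_reduce[OF assms(2)] .
  define B where "B = (\<lambda>(i, j). x ^ i * y ^ j) ` ({..<m} \<times> {..<n})"
  have fin: "finite B" by (simp add: B_def)
  have inB: "x ^ i * y ^ j \<in> int_span B" if "i < m" "j < n" for i j
    using that by (intro int_span_base[OF fin]) (auto simp: B_def)
  have "x * b \<in> int_span B \<and> y * b \<in> int_span B" if "b \<in> B" for b
  proof -
    obtain i j where ij: "i < m" "j < n" "b = x ^ i * y ^ j"
      using \<open>b \<in> B\<close> unfolding B_def by fast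
    have "x ^ Suc i * y ^ j \<in> int_span B"
    \<comment> \<open>The monic relation is needed only when the exponent reaches m.\<close>
    proof (cases "Suc i < m")
      case False
      hence "Suc i = m" using ij by simp
      hence "x ^ Suc i * y ^ j = (\<Sum>i<m. of_int (c i) * (x ^ i * y ^ j))"
        using m(2) by (simp only: sum_distrib_right mult.assoc)
      thus ?thesis using ij by (auto intro!: int_span_sum int_span_of_int_mult inB)
    qed (use ij inB in blast)
    moreover have "x ^ i * y ^ Suc j \<in> int_span B"
    proof (cases "Suc j < n")
      case False
      hence "Suc j = n" using ij by simp
      hence "x ^ i * y ^ Suc j = (\<Sum>j<n. of_int (d j) * (x ^ i * y ^ j))"
        using n(2) by (simp add: sum_distrib_left mult_ac)
      thus ?thesis using ij by (auto intro!: int_span_sum int_span_of_int_mult inB)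
    qed (use ij inB in blast)
    ultimately show ?thesis using ij by (simp add: mult_ac)
  qed
  moreover have "1 \<in> B"
    unfolding B_def by (rule image_eqI[of _ _ "(0, 0)"]) (use m n in auto)
  ultimately show ?thesis using that[of B] fin by blast
qed

lemma algebraic_int_plus:
  fixes x y :: complex
  assumes "algebraic_int x" "algebraic_int y"
  shows "algebraic_int (x + y)"
proof -
  obtain B where B: "finite B" "1 \<in> B" "\<And>b. b \<in> B \<Longrightarrow> x * b \<in> int_span B"
    "\<And>b. b \<in> B \<Longrightarrow> y * b \<in> int_span B"
    using algebraic_int_common_span[OF assms] by blast
  show ?thesis
    by (rule int_span_mult_imp_algebraic_int[OF B(1,2)])
      (auto simp: distrib_right intro: int_span_add B)
qed

lemma algebraic_int_times:
  fixes x y :: complex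
  assumes "algebraic_int x" "algebraic_int y"
  shows "algebraic_int (x * y)"
proof -
  obtain B where B: "finite B" "1 \<in> B" "\<And>b. b \<in> B \<Longrightarrow> x * b \<in> int_span B"
    "\<And>b. b \<in> B \<Longrightarrow> y * b \<in> int_span B"
    using algebraic_int_common_span[OF assms] by blast
  show ?thesis
    by (rule int_span_mult_imp_algebraic_int[OF B(1,2)])
      (auto simp: mult.assoc intro: int_span_mult_closed B)
qed

lemma algebraic_int_1: "algebraic_int (1 :: complex)"
  by (rule int_imp_algebraic_int) simp

lemma algebraic_int_power: "algebraic_int (x :: complex) \<Longrightarrow> algebraic_int (x ^ n)"
  by (induction n) (simp_all add: algebraic_int_times algebraic_int_1)

lemma algebraic_int_sum:
  "(\<And>i. i \<in> A \<Longrightarrow> algebraic_int (f i :: complex)) \<Longrightarrow> algebraic_int (sum f A)"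
  by (induction A rule: infinite_finite_induct) (simp_all add: algebraic_int_plus)

subsection \<open>Conjugation in cyclotomic fields\<close>

definition evq :: "rat poly \<Rightarrow> complex \<Rightarrow> complex" where
  "evq q x = poly (map_poly of_rat q) x"

lemma evq_0 [simp]: "evq 0 x = 0"
  by (simp add: evq_def)

lemma evq_pCons [simp]: "evq (pCons a q) x = of_rat a + x * evq q x"
  by (simp add: evq_def Polynomial.map_poly_pCons)

lemma evq_add [simp]: "evq (p + q) x = evq p x + evq q x"
  by (induction p q rule: poly_induct2) (simp_all add: of_rat_add algebra_simps)

lemma evq_smult [simp]: "evq (smult a q) x = of_rat a * evq q x"
  by (induction q) (simp_all add: of_rat_mult algebra_simps)

lemma evq_mult [simp]: "evq (p * q) x = evq p x * evq q x"
  by (induction p) (simp_all add: algebra_simps)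

lemma evq_1 [simp]: "evq 1 x = 1"
  by (simp add: one_pCons)

lemma evq_minus [simp]: "evq (- q) x = - evq q x"
  using evq_smult[of "-1" q x] by (simp add: of_rat_minus)

lemma evq_diff [simp]: "evq (p - q) x = evq p x - evq q x"
  using evq_add[of p "- q" x] by simp

lemma evq_power [simp]: "evq (p ^ n) x = evq p x ^ n"
  by (induction n) simp_all

lemma evq_pcompose: "evq (p \<circ>\<^sub>p q) x = evq p (evq q x)"
  by (induction p) (simp_all add: pcompose_pCons)

lemma evq_cnj: "evq q (cnj x) = cnj (evq q x)"
proof -
  have "cnj (of_rat a) = of_rat a" for a
    by (induction a) (simp add: of_rat_rat)
  thus ?thesis by (induction q) simp_all
qed

lemma degree_map_of_rat: "degree (map_poly (of_rat :: rat \<Rightarrow> complex) q) = degree q"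
  by (rule degree_map_poly) simp

lemma map_of_rat_nz: "q \<noteq> 0 \<Longrightarrow> map_poly (of_rat :: rat \<Rightarrow> complex) q \<noteq> 0"
  by (metis coeff_0 coeff_map_poly leading_coeff_0_iff of_rat_0 of_rat_eq_0_iff)

lemma evq_eq_sum: "evq q x = (\<Sum>i\<le>degree q. of_rat (coeff q i) * x ^ i)"
  by (simp add: evq_def poly_altdef degree_map_of_rat coeff_map_poly)

text \<open>Conjugates of a root of unity are among its powers. Substituting X^k therefore rewrites
  values at a conjugate as values at the root itself.\<close>

lemma evq_pow_root: "evq q (x ^ k) = evq (q \<circ>\<^sub>p [:0, 1:] ^ k) x"
  by (simp add: evq_pcompose)

text \<open>Equal powers z^i = z^j with i < j < n would give z^(j-i) = 1 against primitivity. The n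
  distinct powers then exhaust the n solutions of w^n = 1.\<close>

lemma primitive_root_of_unity_powers:
  assumes "primitive_root_of_unity n z"
  shows "inj_on (\<lambda>k. z ^ k) {..<n}" "(\<lambda>k. z ^ k) ` {..<n} = {w. w ^ n = 1}"
proof -
  have n: "n > 0" "z ^ n = 1" "\<And>k. 0 < k \<Longrightarrow> k < n \<Longrightarrow> z ^ k \<noteq> 1"
    using assms by (auto simp: primitive_root_of_unity_def)
  have z: "z \<noteq> 0" using n by (metis one_neq_zero power_0_left less_irrefl)
  have neq: "z ^ i \<noteq> z ^ j" if "i < j" "j < n" for i j
  proof
    assume "z ^ i = z ^ j"
    also have "z ^ j = z ^ i * z ^ (j - i)"
      using that by (simp flip: power_add)
    finally have "z ^ (j - i) = 1" using z by simp
    thus False using n(3)[of "j - i"] that by auto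
  qed
  show inj: "inj_on (\<lambda>k. z ^ k) {..<n}"
    by (rule inj_onI) (metis neq lessThan_iff linorder_neqE_nat)
  show "(\<lambda>k. z ^ k) ` {..<n} = {w. w ^ n = 1}"
  proof (rule card_subset_eq)
    show "(\<lambda>k. z ^ k) ` {..<n} \<subseteq> {w. w ^ n = 1}"
      using n by (auto simp: power_mult[symmetric] mult.commute[of _ n] power_mult)
    show "card ((\<lambda>k. z ^ k) ` {..<n}) = card {w :: complex. w ^ n = 1}"
      using card_roots_unity_eq[OF n(1)] inj by (simp add: card_image)
  qed (use finite_roots_unity[of n] n in auto)
qed

lemma algebraic_int_root_of_unity:
  assumes "w ^ n = 1" "n > 0"
  shows "algebraic_int (w :: complex)"
  using algebraic_int_root[of 1 "monom 1 n" w] assms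
  by (simp add: poly_monom degree_monom_eq coeff_monom algebraic_int_1)

section \<open>The minimal polynomial of a primitive root of unity and its roots\<close>

locale cyclotomic =
  fixes N :: nat and \<eta> :: complex
  assumes primitive: "primitive_root_of_unity N \<eta>"
begin

lemma N_pos: "N > 0" and eta_pow: "\<eta> ^ N = 1"
  using primitive by (auto simp: primitive_root_of_unity_def)

lemma root_of_unity_obtain:
  assumes "w ^ N = 1" obtains k where "w = \<eta> ^ k"
  using primitive_root_of_unity_powers(2)[OF primitive] assms by blast

text \<open>Determined only up to a nonzero rational factor; the arguments below use its degree, its
  multiples and its roots.\<close>

definition minpoly :: "rat poly" where
  "minpoly = (SOME p. p \<noteq> 0 \<and> evq p \<eta> = 0 \<and>
     (\<forall>q. q \<noteq> 0 \<longrightarrow> evq q \<eta> = 0 \<longrightarrow> degree p \<le> degree q))"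

text \<open>This is X^N - 1 and not the N-th cyclotomic polynomial. It witnesses that \<eta> is
  algebraic and bounds the set of conjugates.\<close>

definition cycl :: "rat poly" where "cycl = monom 1 N - 1"

lemma evq_cycl: "evq cycl x = x ^ N - 1"
  by (simp add: cycl_def evq_def poly_monom map_poly_monom monom_altdef flip: evq_def)

lemma degree_cycl: "degree cycl = N" and cycl_nz: "cycl \<noteq> 0"
proof -
  show "degree cycl = N"
    using N_pos degree_add_eq_left[of "- 1" "monom (1::rat) N"]
    by (simp add: cycl_def degree_monom_eq)
  thus "cycl \<noteq> 0" using N_pos by auto
qed

lemma minpoly: "minpoly \<noteq> 0" "evq minpoly \<eta> = 0"
    "\<And>q. q \<noteq> 0 \<Longrightarrow> evq q \<eta> = 0 \<Longrightarrow> degree minpoly \<le> degree q"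
proof -
  have "\<exists>p. (p \<noteq> 0 \<and> evq p \<eta> = 0) \<and> (\<forall>q. q \<noteq> 0 \<and> evq q \<eta> = 0 \<longrightarrow> degree p \<le> degree q)"
    using cycl_nz eta_pow by (intro ex_has_least_nat[of _ cycl]) (simp add: evq_cycl)
  hence "\<exists>p. p \<noteq> 0 \<and> evq p \<eta> = 0 \<and> (\<forall>q. q \<noteq> 0 \<longrightarrow> evq q \<eta> = 0 \<longrightarrow> degree p \<le> degree q)"
    by blast
  from someI_ex[OF this] show "minpoly \<noteq> 0" "evq minpoly \<eta> = 0"
    "\<And>q. q \<noteq> 0 \<Longrightarrow> evq q \<eta> = 0 \<Longrightarrow> degree minpoly \<le> degree q"
    unfolding minpoly_def by auto
qed

text \<open>The remainder of \<open>q\<close> modulo \<open>minpoly\<close> also vanishes at \<eta>,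
  so by minimality of the degree it is zero.\<close>

lemma minpoly_dvd:
  assumes "evq q \<eta> = 0"
  shows "minpoly dvd q"
proof -
  have "evq (q mod minpoly) \<eta> = 0"
  proof -
    have "evq q \<eta> = evq (q div minpoly) \<eta> * evq minpoly \<eta> + evq (q mod minpoly) \<eta>"
      by (metis div_mult_mod_eq evq_add evq_mult)
    thus ?thesis using assms minpoly(2) by simp
  qed
  hence "q mod minpoly = 0"
    using minpoly(3)[of "q mod minpoly"] degree_mod_less[OF minpoly(1), of q] by fastforce
  thus ?thesis by auto
qed

definition conjs :: "complex set" where "conjs = {r. evq minpoly r = 0}"

lemma eta_conjs: "\<eta> \<in> conjs"
  by (simp add: conjs_def minpoly)

text \<open>By divisibility, every rational relation satisfied by \<eta> passes to its conjugates;
  this makes the maps \<sigma> below well defined.\<close>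

lemma evq_conjs: "evq q \<eta> = 0 \<Longrightarrow> r \<in> conjs \<Longrightarrow> evq q r = 0"
  using minpoly_dvd[of q] by (auto simp: conjs_def elim!: dvdE)

lemma conjs_pow: "r \<in> conjs \<Longrightarrow> r ^ N = 1"
  using evq_conjs[of cycl r] by (simp add: evq_cycl eta_pow)

lemma conjs_obtain: assumes "r \<in> conjs" obtains k where "r = \<eta> ^ k"
  using conjs_pow[OF assms] root_of_unity_obtain by blast

lemma finite_conjs: "finite conjs"
proof (rule finite_subset)
  show "conjs \<subseteq> {w. w ^ N = 1}" using conjs_pow by auto
qed (use finite_roots_unity[of N] N_pos in auto)

text \<open>The minimal polynomial is separable because it divides $X^N - 1$.\<close>

lemma card_conjs: "card conjs \<ge> degree minpoly"
proof -
  obtain q where q: "cycl = minpoly * q"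
    using minpoly_dvd[of cycl] by (auto simp: evq_cycl eta_pow dvd_def)
  have q0: "q \<noteq> 0" using q cycl_nz by auto
  define Q where "Q = {r. evq q r = 0}"
  have Q: "finite Q" "card Q \<le> degree q"
    using poly_roots_finite[OF map_of_rat_nz[OF q0]]
      card_poly_roots_bound[OF map_of_rat_nz[OF q0]]
    by (simp_all add: Q_def evq_def degree_map_of_rat)
  have "N = card {w :: complex. w ^ N = 1}"
    using card_roots_unity_eq N_pos by simp
  also have "{w. w ^ N = 1} = conjs \<union> Q"
  proof -
    have "w ^ N = 1 \<longleftrightarrow> evq minpoly w * evq q w = 0" for w
      by (simp only: evq_cycl flip: q evq_mult) simp
    thus ?thesis by (auto simp: conjs_def Q_def)
  qed
  also have "card \<dots> \<le> card conjs + card Q"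
    by (rule card_Un_le)
  finally have "N \<le> card conjs + degree q" using Q by simp
  moreover have "N = degree minpoly + degree q"
    using degree_cycl by (simp add: q degree_mult_eq minpoly(1) q0)
  ultimately show ?thesis by simp
qed

section \<open>The field generated by \<eta>, as the set of values of rational polynomials\<close>

definition L :: "complex set" where "L = range (\<lambda>q. evq q \<eta>)"

lemma L_obtain: assumes "x \<in> L" obtains q where "x = evq q \<eta>"
  using assms by (auto simp: L_def)

lemma evq_L [simp, intro]: "evq q \<eta> \<in> L"
  by (auto simp: L_def)

lemma L_eta: "\<eta> \<in> L"
  using evq_L[of "[:0, 1:]"] by simp

lemma L_rat: "of_rat a \<in> L"
  using evq_L[of "[:a:]"] by simp

lemma L_1: "1 \<in> L"
  using evq_L[of 1] by simp

lemma L_0: "0 \<in> L"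
  using evq_L[of 0] by simp

lemma L_add: "x \<in> L \<Longrightarrow> y \<in> L \<Longrightarrow> x + y \<in> L"
  by (metis L_obtain evq_L evq_add)

lemma L_diff: "x \<in> L \<Longrightarrow> y \<in> L \<Longrightarrow> x - y \<in> L"
  by (metis L_obtain evq_L evq_diff)

lemma L_mult: "x \<in> L \<Longrightarrow> y \<in> L \<Longrightarrow> x * y \<in> L"
  by (metis L_obtain evq_L evq_mult)

lemma L_minus: "x \<in> L \<Longrightarrow> - x \<in> L"
  by (metis L_obtain evq_L evq_minus)

lemma L_power: "x \<in> L \<Longrightarrow> x ^ n \<in> L"
  by (induction n) (simp_all add: L_1 L_mult)

lemma L_sum: "(\<And>i. i \<in> A \<Longrightarrow> f i \<in> L) \<Longrightarrow> sum f A \<in> L"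
  by (induction A rule: infinite_finite_induct) (simp_all add: L_0 L_add)

lemma L_root_of_unity: "w ^ N = 1 \<Longrightarrow> w \<in> L"
  using root_of_unity_obtain L_power L_eta by metis

text \<open>Bezout: if x = q(\<eta>) is nonzero, the gcd \<open>g\<close> of \<open>minpoly\<close>
  and \<open>q\<close> does not vanish at \<eta>, so its cofactor in \<open>minpoly\<close> does.
  Minimality of the degree makes \<open>g\<close> a constant, and the Bezout coefficient of
  \<open>q\<close> gives the inverse.\<close>

lemma L_inverse:
  assumes "x \<in> L"
  shows "inverse x \<in> L"
proof (cases "x = 0")
  case False
  obtain q where q: "x = evq q \<eta>" using assms by (rule L_obtain)
  define g where "g = gcd minpoly q"
  obtain a b where ab: "a * minpoly + b * q = g"
    unfolding g_def using bezout_coefficients_fst_snd by blast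
  have "evq g \<eta> = evq b \<eta> * x"
    using minpoly(2) q by (simp flip: ab)
  obtain h where h: "minpoly = g * h" unfolding g_def by (meson dvdE gcd_dvd1)
  have gh: "g \<noteq> 0" "h \<noteq> 0" using h minpoly(1) by auto
  have "evq g \<eta> \<noteq> 0"
  proof
    assume "evq g \<eta> = 0"
    hence "minpoly dvd g" by (rule minpoly_dvd)
    hence "minpoly dvd q" unfolding g_def by simp
    thus False using q False minpoly(2) by (auto simp: dvd_def)
  qed
  hence "evq h \<eta> = 0" using minpoly(2) by (simp add: h)
  hence "degree minpoly \<le> degree h" using gh minpoly(3) by blast
  hence "degree g = 0" using gh by (simp add: h degree_mult_eq)
  then obtain c where c: "g = [:c:]" by (rule degree_eq_zeroE)
  have "c \<noteq> 0" using gh c by auto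
  have "of_rat c = evq b \<eta> * x"
    using \<open>evq g \<eta> = evq b \<eta> * x\<close> c by simp
  moreover from this have "evq b \<eta> \<noteq> 0" using \<open>c \<noteq> 0\<close> by auto
  ultimately have "inverse x = inverse (of_rat c) * evq b \<eta>" by simp
  hence "inverse x = of_rat (inverse c) * evq b \<eta>" by (simp only: of_rat_inverse)
  thus ?thesis by (metis evq_L evq_smult)
qed (simp add: L_0)

lemma L_divide: "x \<in> L \<Longrightarrow> y \<in> L \<Longrightarrow> x / y \<in> L"
  by (simp add: divide_inverse L_mult L_inverse)

section \<open>The automorphisms of the cyclotomic field, indexed by the image of \<eta>\<close>

definition \<sigma> :: "complex \<Rightarrow> complex \<Rightarrow> complex" where
  "\<sigma> r x = evq (SOME q. evq q \<eta> = x) r"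

text \<open>The choice of polynomial is immaterial: two polynomials with the same value at \<eta>
  have a difference vanishing at \<eta>, hence at every conjugate.\<close>

lemma \<sigma>_evq: "r \<in> conjs \<Longrightarrow> \<sigma> r (evq q \<eta>) = evq q r"
proof -
  assume r: "r \<in> conjs"
  have "evq (SOME q'. evq q' \<eta> = evq q \<eta>) \<eta> = evq q \<eta>"
    by (rule someI[of _ q]) simp
  hence "evq ((SOME q'. evq q' \<eta> = evq q \<eta>) - q) \<eta> = 0" by simp
  from evq_conjs[OF this r] show ?thesis by (simp add: \<sigma>_def)
qed

lemma \<sigma>_add: "r \<in> conjs \<Longrightarrow> x \<in> L \<Longrightarrow> y \<in> L \<Longrightarrow> \<sigma> r (x + y) = \<sigma> r x + \<sigma> r y"
  by (metis L_obtain \<sigma>_evq evq_add)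

lemma \<sigma>_diff: "r \<in> conjs \<Longrightarrow> x \<in> L \<Longrightarrow> y \<in> L \<Longrightarrow> \<sigma> r (x - y) = \<sigma> r x - \<sigma> r y"
  by (metis L_obtain \<sigma>_evq evq_diff)

lemma \<sigma>_mult: "r \<in> conjs \<Longrightarrow> x \<in> L \<Longrightarrow> y \<in> L \<Longrightarrow> \<sigma> r (x * y) = \<sigma> r x * \<sigma> r y"
  by (metis L_obtain \<sigma>_evq evq_mult)

lemma \<sigma>_rat: "r \<in> conjs \<Longrightarrow> \<sigma> r (of_rat a) = of_rat a"
  using \<sigma>_evq[of r "[:a:]"] by simp

lemma \<sigma>_1: "r \<in> conjs \<Longrightarrow> \<sigma> r 1 = 1" and \<sigma>_0: "r \<in> conjs \<Longrightarrow> \<sigma> r 0 = 0"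
  using \<sigma>_evq[of r 1] \<sigma>_evq[of r 0] by simp_all

lemma \<sigma>_power: "r \<in> conjs \<Longrightarrow> x \<in> L \<Longrightarrow> \<sigma> r (x ^ n) = \<sigma> r x ^ n"
  by (metis L_obtain \<sigma>_evq evq_power)

lemma \<sigma>_sum: "r \<in> conjs \<Longrightarrow> (\<And>i. i \<in> A \<Longrightarrow> f i \<in> L) \<Longrightarrow> \<sigma> r (sum f A) = (\<Sum>i\<in>A. \<sigma> r (f i))"
  by (induction A rule: infinite_finite_induct) (simp_all add: \<sigma>_0 \<sigma>_add L_sum)

lemma \<sigma>_eta: "r \<in> conjs \<Longrightarrow> \<sigma> r \<eta> = r"
  using \<sigma>_evq[of r "[:0, 1:]"] by simp

lemma \<sigma>_closed: "r \<in> conjs \<Longrightarrow> x \<in> L \<Longrightarrow> \<sigma> r x \<in> L"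
  by (metis L_obtain \<sigma>_evq evq_L evq_pow_root conjs_obtain)

text \<open>With r' = \<eta>^k, the polynomial \<open>minpoly\<close> composed with X^k vanishes at
  \<eta>, hence at r; so r^k, the image of r', is again a conjugate.\<close>

lemma \<sigma>_conjs: "r \<in> conjs \<Longrightarrow> r' \<in> conjs \<Longrightarrow> \<sigma> r r' \<in> conjs"
proof -
  assume r: "r \<in> conjs" "r' \<in> conjs"
  obtain k where k: "r' = \<eta> ^ k" using r(2) by (rule conjs_obtain)
  have "evq (minpoly \<circ>\<^sub>p [:0, 1:] ^ k) \<eta> = 0"
    using r(2) by (simp add: conjs_def k flip: evq_pow_root)
  from evq_conjs[OF this r(1)] have "r ^ k \<in> conjs"
    by (simp add: conjs_def flip: evq_pow_root)
  thus ?thesis using r(1) by (simp add: k \<sigma>_power L_eta \<sigma>_eta)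
qed

lemma \<sigma>_\<sigma>: "r \<in> conjs \<Longrightarrow> r' \<in> conjs \<Longrightarrow> x \<in> L \<Longrightarrow> \<sigma> r (\<sigma> r' x) = \<sigma> (\<sigma> r r') x"
proof -
  assume r: "r \<in> conjs" "r' \<in> conjs" and x: "x \<in> L"
  obtain k where k: "r' = \<eta> ^ k" using r(2) by (rule conjs_obtain)
  obtain q where q: "x = evq q \<eta>" using x by (rule L_obtain)
  have "\<sigma> r (\<sigma> r' x) = evq q (r ^ k)"
    using \<sigma>_evq[OF r(1), of "q \<circ>\<^sub>p [:0, 1:] ^ k"] \<sigma>_evq[OF r(2)] k q
    by (simp flip: evq_pow_root)
  also have "r ^ k = \<sigma> r r'" using r(1) by (simp add: k \<sigma>_power L_eta \<sigma>_eta)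
  finally show ?thesis using \<sigma>_evq[OF \<sigma>_conjs[OF r]] q by simp
qed

text \<open>If r = \<eta>^j and r' = \<eta>^k, both compositions send \<eta> to \<eta>^(jk).\<close>

lemma \<sigma>_commute: "r \<in> conjs \<Longrightarrow> r' \<in> conjs \<Longrightarrow> x \<in> L \<Longrightarrow> \<sigma> r (\<sigma> r' x) = \<sigma> r' (\<sigma> r x)"
proof -
  assume r: "r \<in> conjs" "r' \<in> conjs" and x: "x \<in> L"
  obtain k where k: "r' = \<eta> ^ k" using r(2) by (rule conjs_obtain)
  obtain j where j: "r = \<eta> ^ j" using r(1) by (rule conjs_obtain)
  have "\<sigma> r r' = r ^ k" using r(1) by (simp add: k \<sigma>_power L_eta \<sigma>_eta)
  moreover have "\<sigma> r' r = r' ^ j" using r(2) by (simp add: j \<sigma>_power L_eta \<sigma>_eta)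
  moreover have "r ^ k = r' ^ j" by (simp add: j k power_mult[symmetric] mult.commute)
  ultimately show ?thesis using \<sigma>_\<sigma>[OF r x] \<sigma>_\<sigma>[OF r(2,1) x] by simp
qed

lemma \<sigma>_nz: "r \<in> conjs \<Longrightarrow> x \<in> L \<Longrightarrow> x \<noteq> 0 \<Longrightarrow> \<sigma> r x \<noteq> 0"
proof
  assume r: "r \<in> conjs" and x: "x \<in> L" "x \<noteq> 0" and "\<sigma> r x = 0"
  hence "\<sigma> r (x * inverse x) = 0"
    using \<sigma>_mult[OF r x(1) L_inverse[OF x(1)]] by simp
  thus False using x r by (simp add: \<sigma>_1)
qed

lemma \<sigma>_inj: "r \<in> conjs \<Longrightarrow> inj_on (\<sigma> r) L"
proof (rule inj_onI)
  fix x y assume "r \<in> conjs" "x \<in> L" "y \<in> L" "\<sigma> r x = \<sigma> r y"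
  thus "x = y" using \<sigma>_nz[of r "x - y"] by (auto simp: \<sigma>_diff L_diff)
qed

lemma \<sigma>_inverse: "r \<in> conjs \<Longrightarrow> x \<in> L \<Longrightarrow> \<sigma> r (inverse x) = inverse (\<sigma> r x)"
proof (cases "x = 0")
  case False
  assume r: "r \<in> conjs" and x: "x \<in> L"
  have "\<sigma> r x * \<sigma> r (inverse x) = 1"
    using r x False by (simp add: \<sigma>_1 L_inverse flip: \<sigma>_mult)
  thus ?thesis using inverse_unique by metis
qed (simp add: \<sigma>_0)

lemma \<sigma>_divide: "r \<in> conjs \<Longrightarrow> x \<in> L \<Longrightarrow> y \<in> L \<Longrightarrow> \<sigma> r (x / y) = \<sigma> r x / \<sigma> r y"
  by (simp add: divide_inverse \<sigma>_mult \<sigma>_inverse L_inverse)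

lemma cnj_eta_conjs: "cnj \<eta> \<in> conjs"
  by (simp add: conjs_def evq_cnj minpoly)

lemma \<sigma>_cnj_eta: "x \<in> L \<Longrightarrow> \<sigma> (cnj \<eta>) x = cnj x"
  by (metis L_obtain \<sigma>_evq cnj_eta_conjs evq_cnj)

lemma L_cnj: "x \<in> L \<Longrightarrow> cnj x \<in> L"
  by (metis \<sigma>_cnj_eta \<sigma>_closed cnj_eta_conjs)

text \<open>Complex conjugation is itself the automorphism of index \<open>cnj \<eta>\<close>, so
  this is an instance of commutativity.\<close>

lemma \<sigma>_cnj: "r \<in> conjs \<Longrightarrow> x \<in> L \<Longrightarrow> \<sigma> r (cnj x) = cnj (\<sigma> r x)"
  by (metis \<sigma>_cnj_eta \<sigma>_closed \<sigma>_commute cnj_eta_conjs)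

text \<open>Write x = q(\<eta>) with the degree of \<open>q\<close> below that of
  \<open>minpoly\<close>. Then \<open>q\<close> takes the value x at all conjugates, which are more
  numerous than its degree, so \<open>q\<close> is the constant x.\<close>

lemma fixed_imp_rat:
  assumes x: "x \<in> L" and fixed: "\<And>r. r \<in> conjs \<Longrightarrow> \<sigma> r x = x"
  shows "x \<in> \<rat>"
proof -
  obtain q0 where q0: "x = evq q0 \<eta>" using x by (rule L_obtain)
  define q where "q = q0 mod minpoly"
  have "evq q0 \<eta> = evq (q0 div minpoly) \<eta> * evq minpoly \<eta> + evq q \<eta>"
    unfolding q_def by (metis div_mult_mod_eq evq_add evq_mult)
  hence q: "x = evq q \<eta>" using q0 minpoly(2) by simp
  have deg: "degree minpoly > 0"
  proof (rule ccontr)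
    assume "\<not> degree minpoly > 0"
    then obtain c where "minpoly = [:c:]" using degree_eq_zeroE by blast
    thus False using minpoly(1,2) by simp
  qed
  have degq: "degree q < degree minpoly"
    using degree_mod_less[OF minpoly(1), of q0] deg by (auto simp: q_def)
  have "map_poly of_rat q = [:x:]"
  proof (rule poly_eqI_degree)
    show "poly (map_poly of_rat q) r = poly [:x:] r" if "r \<in> conjs" for r
      using \<sigma>_evq[OF that, of q] fixed[OF that] q by (simp add: evq_def)
  qed (use card_conjs degq deg in \<open>simp_all add: degree_map_of_rat\<close>)
  hence "x = of_rat (coeff q 0)"
    by (metis coeff_map_poly coeff_pCons_0 of_rat_0)
  thus ?thesis by simp
qed

section \<open>The trace to the rationals and finiteness of bounded algebraic integers\<close>

definition tr :: "complex \<Rightarrow> complex" where "tr x = (\<Sum>r\<in>conjs. \<sigma> r x)"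

text \<open>Each automorphism permutes the finite set of conjugates, hence the summands of the
  trace.\<close>

lemma tr_rat: "x \<in> L \<Longrightarrow> tr x \<in> \<rat>"
proof (rule fixed_imp_rat)
  assume x: "x \<in> L"
  show "tr x \<in> L" unfolding tr_def using x by (intro L_sum \<sigma>_closed)
  fix r assume r: "r \<in> conjs"
  have conjs_L: "conjs \<subseteq> L"
    using \<sigma>_eta \<sigma>_closed[OF _ L_eta] by fastforce
  have bij: "bij_betw (\<sigma> r) conjs conjs"
    unfolding bij_betw_def
  proof (intro conjI)
    show inj: "inj_on (\<sigma> r) conjs" using \<sigma>_inj[OF r] conjs_L by (rule inj_on_subset)
    show "\<sigma> r ` conjs = conjs"
      using r by (intro endo_inj_surj finite_conjs inj) (auto intro: \<sigma>_conjs)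
  qed
  have "\<sigma> r (tr x) = (\<Sum>r'\<in>conjs. \<sigma> r (\<sigma> r' x))"
    unfolding tr_def by (rule \<sigma>_sum[OF r]) (rule \<sigma>_closed[OF _ x])
  also have "\<dots> = (\<Sum>r'\<in>conjs. \<sigma> (\<sigma> r r') x)"
    using r x by (intro sum.cong refl \<sigma>_\<sigma>)
  also have "\<dots> = tr x"
    unfolding tr_def using bij by (rule sum.reindex_bij_betw)
  finally show "\<sigma> r (tr x) = tr x" .
qed

text \<open>The monic integer polynomial of x also annihilates its conjugates: composed with a
  polynomial representing x, it vanishes at \<eta> and hence at r.\<close>

lemma \<sigma>_algebraic_int:
  assumes "r \<in> conjs" "x \<in> L" "algebraic_int x"
  shows "algebraic_int (\<sigma> r x)"
proof -
  obtain p where p: "poly (map_poly of_int p) x = 0" "lead_coeff p = 1"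
    using assms(3) by (auto simp: algebraic_int_altdef_ipoly)
  define P where "P = map_poly rat_of_int p"
  have P: "evq P y = poly (map_poly of_int p) y" for y
    unfolding evq_def P_def by (subst map_poly_map_poly) (simp_all add: o_def)
  obtain q where q: "x = evq q \<eta>" using assms(2) by (rule L_obtain)
  have "evq (P \<circ>\<^sub>p q) \<eta> = 0" using p(1) P q by (simp add: evq_pcompose)
  hence "evq (P \<circ>\<^sub>p q) r = 0" using assms(1) by (rule evq_conjs)
  hence "poly (map_poly of_int p) (\<sigma> r x) = 0"
    using P q assms(1) by (simp add: evq_pcompose \<sigma>_evq)
  thus ?thesis using p(2) by (auto simp: algebraic_int_altdef_ipoly)
qed

text \<open>The trace form is nondegenerate, so an element is determined by the traces of its
  products with the powers of $\eta$; for a bounded integer these are bounded integers.\<close>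

lemma finite_bounded_algebraic_ints:
  "finite {x \<in> L. algebraic_int x \<and> (\<forall>r\<in>conjs. cmod (\<sigma> r x) \<le> C)}" (is "finite ?A")
proof -
  define \<Phi> where "\<Phi> = (\<lambda>x. restrict (\<lambda>i. tr (x * \<eta> ^ i)) {..<N})"
  \<comment> \<open>Multiplying by \<eta>^i leaves the absolute value of each conjugate unchanged,
    so every trace in question is a sum of \<open>card conjs\<close> terms of size at most
    C.\<close>
  define I where "I = complex_of_int ` {k. \<bar>real_of_int k\<bar> \<le> real (card conjs) * C}"
  have "{k. \<bar>real_of_int k\<bar> \<le> real (card conjs) * C} \<subseteq>
      {- \<lceil>real (card conjs) * C\<rceil> .. \<lceil>real (card conjs) * C\<rceil>}"
    by (auto simp: abs_le_iff) linarith+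
  hence "finite I" unfolding I_def using finite_subset by blast
  have "\<Phi> ` ?A \<subseteq> {..<N} \<rightarrow>\<^sub>E I"
  proof (rule image_subsetI, rule PiE_I)
    fix x i assume "x \<in> ?A" and i: "i \<in> {..<N}"
    hence x: "x \<in> L" "algebraic_int x" "\<And>r. r \<in> conjs \<Longrightarrow> cmod (\<sigma> r x) \<le> C" by auto
    let ?y = "x * \<eta> ^ i"
    have y: "?y \<in> L" using x(1) by (intro L_mult L_power L_eta)
    have "algebraic_int \<eta>"
      using eta_pow N_pos by (rule algebraic_int_root_of_unity)
    hence ya: "algebraic_int ?y"
      using x(2) by (intro algebraic_int_times algebraic_int_power)
    have "algebraic_int (tr ?y)"
      unfolding tr_def by (intro algebraic_int_sum \<sigma>_algebraic_int y ya)
    hence "tr ?y \<in> \<int>" using tr_rat[OF y] by (rule rational_algebraic_int_is_int)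
    then obtain k where k: "tr ?y = of_int k" by (auto elim: Ints_cases)
    have "cmod (\<sigma> r ?y) \<le> C" if r: "r \<in> conjs" for r
    proof -
      have "cmod r = 1" using power_eq_1_iff[OF conjs_pow[OF r]] N_pos by simp
      thus ?thesis using x(1,3) r by (simp add: \<sigma>_mult L_power L_eta \<sigma>_power \<sigma>_eta norm_mult norm_power)
    qed
    hence "cmod (tr ?y) \<le> (\<Sum>r\<in>conjs. C)"
      unfolding tr_def by (intro sum_norm_le)
    hence "\<bar>real_of_int k\<bar> \<le> real (card conjs) * C" by (simp add: k)
    thus "\<Phi> x i \<in> I" using i k by (simp add: \<Phi>_def I_def)
  qed (simp add: \<Phi>_def)
  moreover have "finite ({..<N} \<rightarrow>\<^sub>E I)" using \<open>finite I\<close> by (intro finite_PiE) auto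
  ultimately have "finite (\<Phi> ` ?A)" by (rule finite_subset)
  moreover have "inj_on \<Phi> L"
  proof (rule inj_onI, rule ccontr)
    fix x y assume x: "x \<in> L" and y: "y \<in> L" and eq: "\<Phi> x = \<Phi> y" and "x \<noteq> y"
    define z where "z = x - y"
    have z: "z \<in> L" "z \<noteq> 0" using x y \<open>x \<noteq> y\<close> by (auto simp: z_def L_diff)
    \<comment> \<open>The restricted maps compare only exponents below N; \<eta>^N = 1 extends the
      equality to all exponents.\<close>
    have tr0: "tr (z * \<eta> ^ i) = 0" for i
    proof -
      have "\<eta> ^ i = (\<eta> ^ N) ^ (i div N) * \<eta> ^ (i mod N)"
        by (simp flip: power_mult power_add)
      hence i: "\<eta> ^ i = \<eta> ^ (i mod N)" by (simp add: eta_pow)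
      have "tr (x * \<eta> ^ (i mod N)) = tr (y * \<eta> ^ (i mod N))"
        using fun_cong[OF eq, of "i mod N"] N_pos by (simp add: \<Phi>_def)
      thus ?thesis
        using x y by (simp add: i z_def tr_def left_diff_distrib \<sigma>_diff L_mult L_power L_eta sum_subtractf)
    qed
    \<comment> \<open>Expanding the inverse of z in powers of \<eta> turns the trace of 1, the
      positive number of conjugates, into a combination of the vanishing traces.\<close>
    obtain q where q: "inverse z = evq q \<eta>" using L_inverse[OF z(1)] by (rule L_obtain)
    have "of_nat (card conjs) = tr (z * inverse z)"
      using z by (simp add: tr_def \<sigma>_1)
    also have "\<dots> = tr (\<Sum>i\<le>degree q. of_rat (coeff q i) * (z * \<eta> ^ i))"
      by (simp add: q evq_eq_sum sum_distrib_left mult_ac)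
    also have "\<dots> = (\<Sum>r\<in>conjs. \<Sum>i\<le>degree q. of_rat (coeff q i) * \<sigma> r (z * \<eta> ^ i))"
      unfolding tr_def
      by (intro sum.cong refl, subst \<sigma>_sum)
        (auto simp: \<sigma>_mult[OF _ L_rat] \<sigma>_rat z L_mult L_power L_eta L_rat)
    also have "\<dots> = (\<Sum>i\<le>degree q. of_rat (coeff q i) * tr (z * \<eta> ^ i))"
      by (subst sum.swap) (simp add: tr_def sum_distrib_left)
    finally have "card conjs = 0" by (simp add: tr0)
    thus False using eta_conjs finite_conjs by auto
  qed
  hence "inj_on \<Phi> ?A" by (rule inj_on_subset) auto
  ultimately show ?thesis by (rule finite_imageD)
qed

end

subsection \<open>Fractional ideals and the class number\<close>

text \<open>The orbits of \<open>f\<close> partition the set, and without fixed points each has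
  exactly three elements.\<close>

lemma three_dvd_card_if_order_three:
  assumes "finite S" and f: "\<And>x. x \<in> S \<Longrightarrow> f x \<in> S" "\<And>x. x \<in> S \<Longrightarrow> f (f (f x)) = x"
    and nofix: "\<And>x. x \<in> S \<Longrightarrow> f x \<noteq> x"
  shows "3 dvd card S"
proof -
  define orb where "orb = (\<lambda>x. {x, f x, f (f x)})"
  have "\<Union> (orb ` S) = S" using f by (auto simp: orb_def)
  moreover have "3 dvd card (\<Union> (orb ` S))"
  proof (rule dvd_partition)
    show "finite (\<Union> (orb ` S))" using assms(1) by (auto simp: orb_def)
    have "card (orb x) = 3" if "x \<in> S" for x
    proof -
      \<comment> \<open>If f (f x) = x, applying \<open>f\<close> once more gives f x = f (f (f x))
        = x, a fixed point.\<close>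
      have "f x \<noteq> x" "f (f x) \<noteq> f x" "f (f x) \<noteq> x"
        using nofix f that by metis+
      thus ?thesis by (auto simp: orb_def)
    qed
    thus "\<forall>c\<in>orb ` S. 3 dvd card c" by auto
    have orb_f: "orb (f x) = orb x" if "x \<in> S" for x
      using f that by (auto simp: orb_def)
    have "orb y = orb x" if "x \<in> S" "y \<in> orb x" for x y
    proof -
      have "y = x \<or> y = f x \<or> y = f (f x)" using that(2) by (simp add: orb_def)
      thus ?thesis using orb_f[OF that(1)] orb_f[OF f(1)[OF that(1)]] by auto
    qed
    thus "\<forall>c1\<in>orb ` S. \<forall>c2\<in>orb ` S. c1 \<noteq> c2 \<longrightarrow> c1 \<inter> c2 = {}"
      by blast
  qed
  ultimately show ?thesis by simp
qed

section \<open>The field generated by a complex number and its ring of integers\<close>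

abbreviation CC :: "complex ring" where "CC \<equiv> ring_of_type_algebra"

lemma CC_simps [simp]:
  "carrier CC = UNIV" "x \<otimes>\<^bsub>CC\<^esub> y = x * y" "x \<oplus>\<^bsub>CC\<^esub> y = x + y" "\<one>\<^bsub>CC\<^esub> = 1" "\<zero>\<^bsub>CC\<^esub> = 0"
  by (simp_all add: ring_of_type_algebra_def)

lemma CC_field: "field CC"
  by (rule field_from_type_algebra)

lemma CC_a_inv [simp]: "\<ominus>\<^bsub>CC\<^esub> x = - x"
proof -
  interpret field CC by (rule CC_field)
  show ?thesis by (rule minus_equality) simp_all
qed

lemma CC_m_inv: "x \<noteq> 0 \<Longrightarrow> inv\<^bsub>CC\<^esub> x = inverse x"
proof -
  assume "x \<noteq> 0"
  interpret field CC by (rule CC_field)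
  show ?thesis by (rule comm_inv_char) (use \<open>x \<noteq> 0\<close> in simp_all)
qed

lemma rat_adjoin_self: "z \<in> rat_adjoin z"
  unfolding rat_adjoin_def by (rule generate_field.incl) simp

lemma rat_adjoin_1: "1 \<in> rat_adjoin z"
  unfolding rat_adjoin_def using generate_field.one[of CC "{z}"] by simp

lemma rat_adjoin_add: "x \<in> rat_adjoin z \<Longrightarrow> y \<in> rat_adjoin z \<Longrightarrow> x + y \<in> rat_adjoin z"
  unfolding rat_adjoin_def using generate_field.eng_add[of x CC "{z}" y] by simp

lemma rat_adjoin_mult: "x \<in> rat_adjoin z \<Longrightarrow> y \<in> rat_adjoin z \<Longrightarrow> x * y \<in> rat_adjoin z"
  unfolding rat_adjoin_def using generate_field.eng_mult[of x CC "{z}" y] by simp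

lemma rat_adjoin_minus: "x \<in> rat_adjoin z \<Longrightarrow> - x \<in> rat_adjoin z"
  unfolding rat_adjoin_def using generate_field.a_inv[of x CC "{z}"] by simp

lemma rat_adjoin_diff: "x \<in> rat_adjoin z \<Longrightarrow> y \<in> rat_adjoin z \<Longrightarrow> x - y \<in> rat_adjoin z"
  using rat_adjoin_add[of x z "- y"] rat_adjoin_minus[of y z] by simp

lemma rat_adjoin_0: "0 \<in> rat_adjoin z"
  using rat_adjoin_diff[OF rat_adjoin_1 rat_adjoin_1] by simp

lemma rat_adjoin_inverse: "x \<in> rat_adjoin z \<Longrightarrow> inverse x \<in> rat_adjoin z"
  unfolding rat_adjoin_def using generate_field.m_inv[of x CC "{z}"]
    rat_adjoin_0[unfolded rat_adjoin_def]
  by (cases "x = 0") (simp_all add: CC_m_inv)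

lemma rat_adjoin_divide: "x \<in> rat_adjoin z \<Longrightarrow> y \<in> rat_adjoin z \<Longrightarrow> x / y \<in> rat_adjoin z"
  by (simp add: divide_inverse rat_adjoin_mult rat_adjoin_inverse)

lemma rat_adjoin_power: "x \<in> rat_adjoin z \<Longrightarrow> x ^ n \<in> rat_adjoin z"
  by (induction n) (simp_all add: rat_adjoin_1 rat_adjoin_mult)

lemma rat_adjoin_of_nat: "of_nat n \<in> rat_adjoin z"
  by (induction n) (simp_all add: rat_adjoin_0 rat_adjoin_1 rat_adjoin_add)

lemma rat_adjoin_of_int: "of_int n \<in> rat_adjoin z"
  by (cases n) (simp_all only: of_int_of_nat_eq of_int_minus rat_adjoin_of_nat rat_adjoin_minus)

lemma rat_adjoin_numeral: "numeral n \<in> rat_adjoin z"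
  using rat_adjoin_of_nat[of "numeral n" z] by simp

lemma rat_adjoin_prod: "(\<And>i. i \<in> A \<Longrightarrow> f i \<in> rat_adjoin z) \<Longrightarrow> prod f A \<in> rat_adjoin z"
  by (induction A rule: infinite_finite_induct) (simp_all add: rat_adjoin_1 rat_adjoin_mult)

lemmas rat_adjoin_closed = rat_adjoin_self rat_adjoin_1 rat_adjoin_0 rat_adjoin_add rat_adjoin_mult
  rat_adjoin_minus rat_adjoin_diff rat_adjoin_inverse rat_adjoin_divide rat_adjoin_power
  rat_adjoin_of_nat rat_adjoin_of_int rat_adjoin_numeral

abbreviation ints :: "complex \<Rightarrow> complex set" where
  "ints z \<equiv> carrier (ring_of_integers (rat_adjoin z))"

lemma ints_iff: "x \<in> ints z \<longleftrightarrow> x \<in> rat_adjoin z \<and> algebraic_int x"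
  by (simp add: ring_of_integers_def)

lemma ints_closed:
  "0 \<in> ints z" "1 \<in> ints z" "of_int k \<in> ints z"
  "x \<in> ints z \<Longrightarrow> y \<in> ints z \<Longrightarrow> x + y \<in> ints z"
  "x \<in> ints z \<Longrightarrow> y \<in> ints z \<Longrightarrow> x * y \<in> ints z"
  "x \<in> ints z \<Longrightarrow> - x \<in> ints z"
  by (auto simp: ints_iff algebraic_int_plus algebraic_int_times algebraic_int_1
      algebraic_int_minus int_imp_algebraic_int intro!: rat_adjoin_closed)

lemma ints_power: "x \<in> ints z \<Longrightarrow> x ^ n \<in> ints z"
  by (induction n) (simp_all add: ints_closed)

lemma ring_of_integers_simps [simp]:
  "x \<otimes>\<^bsub>ring_of_integers K\<^esub> y = x * y" "x \<oplus>\<^bsub>ring_of_integers K\<^esub> y = x + y"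
  "\<one>\<^bsub>ring_of_integers K\<^esub> = 1" "\<zero>\<^bsub>ring_of_integers K\<^esub> = 0"
  by (simp_all add: ring_of_integers_def)

lemma ring_ring_of_integers: "ring (ring_of_integers (rat_adjoin z))"
proof -
  interpret field CC by (rule CC_field)
  have "subring (ints z) CC"
    by (rule subringI) (auto simp: ints_closed)
  moreover have "ring_of_integers (rat_adjoin z) = CC\<lparr>carrier := ints z\<rparr>"
    by (simp add: ring_of_integers_def)
  ultimately show ?thesis using subring_is_ring by metis
qed

lemma ring_of_integers_a_inv:
  assumes "x \<in> ints z"
  shows "\<ominus>\<^bsub>ring_of_integers (rat_adjoin z)\<^esub> x = - x"
proof -
  interpret ring "ring_of_integers (rat_adjoin z)" by (rule ring_ring_of_integers)
  show ?thesis by (rule minus_equality) (use assms in \<open>simp_all add: ints_closed\<close>)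
qed

text \<open>Multiplication by the denominator \<open>d\<close> passes between such a module and an
  ideal; negatives come from multiplying by the integer -1. This form lets fractional ideals be
  handled elementwise.\<close>

lemma fractional_ideals_iff:
  "I \<in> fractional_ideals (rat_adjoin z) \<longleftrightarrow>
     0 \<in> I \<and> (\<exists>x\<in>I. x \<noteq> 0) \<and> (\<forall>x\<in>I. \<forall>y\<in>I. x + y \<in> I) \<and> (\<forall>a\<in>ints z. \<forall>x\<in>I. a * x \<in> I) \<and>
     (\<exists>d\<in>ints z. d \<noteq> 0 \<and> (\<forall>x\<in>I. d * x \<in> ints z))" (is "?L \<longleftrightarrow> ?R")
proof
  assume ?L
  then obtain J d where J: "ideal J (ring_of_integers (rat_adjoin z))" "J \<noteq> {0}"
    and d: "d \<in> ints z" "d \<noteq> 0" and I: "I = (\<lambda>x. x / d) ` J"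
    by (auto simp: fractional_ideals_def)
  interpret J: ideal J "ring_of_integers (rat_adjoin z)" by fact
  have J0: "0 \<in> J" using additive_subgroup.zero_closed[OF J.is_additive_subgroup] by simp
  have Jadd: "x + y \<in> J" if "x \<in> J" "y \<in> J" for x y using additive_subgroup.a_closed[OF J.is_additive_subgroup that] by simp
  have Jmult: "a * x \<in> J" if "a \<in> ints z" "x \<in> J" for a x using J.I_l_closed[OF that(2,1)] by simp
  have Jsub: "x \<in> ints z" if "x \<in> J" for x using J.Icarr[OF that] .
  obtain x where x: "x \<in> J" "x \<noteq> 0" using J(2) J0 by auto
  show ?R
  proof (intro conjI ballI)
    show "0 \<in> I" unfolding I using J0 by (intro image_eqI[of _ _ 0]) auto
    show "\<exists>x\<in>I. x \<noteq> 0" unfolding I using x d by auto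
    show "x + y \<in> I" if "x \<in> I" "y \<in> I" for x y
      using that Jadd unfolding I by (auto simp flip: add_divide_distrib)
    show "a * x \<in> I" if "a \<in> ints z" "x \<in> I" for a x
      using that Jmult unfolding I by auto
    show "\<exists>d\<in>ints z. d \<noteq> 0 \<and> (\<forall>x\<in>I. d * x \<in> ints z)"
      using d Jsub unfolding I by (intro bexI[of _ d]) auto
  qed
next
  assume ?R
  then obtain d where d: "d \<in> ints z" "d \<noteq> 0" "\<And>x. x \<in> I \<Longrightarrow> d * x \<in> ints z"
    and I: "0 \<in> I" "\<exists>x\<in>I. x \<noteq> 0" "\<And>x y. x \<in> I \<Longrightarrow> y \<in> I \<Longrightarrow> x + y \<in> I"
      "\<And>a x. a \<in> ints z \<Longrightarrow> x \<in> I \<Longrightarrow> a * x \<in> I"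
    by auto
  define J where "J = (\<lambda>x. d * x) ` I"
  have I_minus: "- x \<in> I" if "x \<in> I" for x
    using I(4)[of "-1" x] that ints_closed(6)[OF ints_closed(2)] by simp
  have "ideal J (ring_of_integers (rat_adjoin z))"
  proof (rule idealI)
    show "subgroup J (add_monoid (ring_of_integers (rat_adjoin z)))"
    proof
      fix x assume x: "x \<in> J"
      hence xi: "x \<in> ints z" using d by (auto simp: J_def)
      obtain y where y: "y \<in> I" "x = d * y" using x by (auto simp: J_def)
      have "- x \<in> J" unfolding J_def
        by (rule image_eqI[of _ _ "- y"]) (use y I_minus in simp_all)
      moreover have "inv\<^bsub>add_monoid (ring_of_integers (rat_adjoin z))\<^esub> x = - x"
        using ring_of_integers_a_inv[OF xi] by (simp add: a_inv_def)
      ultimately show "inv\<^bsub>add_monoid (ring_of_integers (rat_adjoin z))\<^esub> x \<in> J" by simp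
    qed (use d I in \<open>auto simp: J_def simp flip: distrib_left\<close>)
    have mult: "a * x \<in> J" if "x \<in> J" "a \<in> ints z" for a x
    proof -
      obtain y where "y \<in> I" "x = d * y" using \<open>x \<in> J\<close> by (auto simp: J_def)
      thus ?thesis unfolding J_def
        by (intro image_eqI[of _ _ "a * y"]) (use that I(4) in simp_all)
    qed
    show "a \<otimes>\<^bsub>ring_of_integers (rat_adjoin z)\<^esub> x \<in> J"
      "x \<otimes>\<^bsub>ring_of_integers (rat_adjoin z)\<^esub> a \<in> J" if "x \<in> J" "a \<in> ints z" for a x
      using mult[OF that] by (simp_all add: mult.commute)
  qed (rule ring_ring_of_integers)
  moreover have "J \<noteq> {0}"
  proof -
    obtain x where "x \<in> I" "x \<noteq> 0" using I(2) by auto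
    hence "d * x \<in> J" "d * x \<noteq> 0" using d(2) by (simp_all add: J_def)
    thus ?thesis by blast
  qed
  moreover have "I = (\<lambda>x. x / d) ` J" using d(2) by (auto simp: J_def image_image)
  ultimately show ?L using d(1,2) by (auto simp: fractional_ideals_def)
qed

text \<open>Each product a b x with b integral lies in a I because \<open>I\<close> absorbs
  integers, and sums stay there; conversely a x is already a product. This turns cosets of principal
  ideals into sets of multiples.\<close>

lemma principal_mult_fractional:
  assumes I: "I \<in> fractional_ideals (rat_adjoin z)"
  shows "ideal_prod CC ((\<lambda>x. a * x) ` ints z) I = (\<lambda>x. a * x) ` I"
proof (intro equalityI subsetI)
  note I' = I[unfolded fractional_ideals_iff]
  fix x assume "x \<in> ideal_prod CC ((\<lambda>x. a * x) ` ints z) I"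
  thus "x \<in> (\<lambda>x. a * x) ` I"
  proof induction
    case (prod i j)
    thus ?case using I' by (auto simp: mult.assoc)
  next
    case (sum s1 s2)
    thus ?case using I' by (auto simp flip: distrib_left)
  qed
next
  fix x assume "x \<in> (\<lambda>x. a * x) ` I"
  then obtain y where y: "y \<in> I" "x = a * y" by auto
  have "a \<in> (\<lambda>x. a * x) ` ints z"
    using ints_closed(2) by (intro image_eqI[of _ _ 1]) auto
  from ideal_prod.prod[OF this y(1), of CC]
  show "x \<in> ideal_prod CC ((\<lambda>x. a * x) ` ints z) I" using y by simp
qed

text \<open>The ideal class of \<open>I\<close>, written as an explicit set of scalings.\<close>

definition homothety_class :: "complex \<Rightarrow> complex set \<Rightarrow> complex set set" where
  "homothety_class z I = {(\<lambda>x. a * x) ` I | a. a \<in> rat_adjoin z \<and> a \<noteq> 0}"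

text \<open>The cosets forming the quotient are the homothety classes, so counting classes requires
  no group laws. An infinite set of classes has \<open>card\<close> 0 on the right.\<close>

lemma class_number_eq:
  "class_number (rat_adjoin z) = card (homothety_class z ` fractional_ideals (rat_adjoin z))"
proof -
  let ?K = "rat_adjoin z"
  have "principal_fractional_ideals ?K #>\<^bsub>fractional_ideal_group ?K\<^esub> I = homothety_class z I"
    if "I \<in> fractional_ideals ?K" for I
    using principal_mult_fractional[OF that]
    by (auto simp: r_coset_def fractional_ideal_group_def principal_fractional_ideals_def
        homothety_class_def)
  hence "rcosets\<^bsub>fractional_ideal_group ?K\<^esub> (principal_fractional_ideals ?K) =
      homothety_class z ` fractional_ideals ?K"
    unfolding RCOSETS_def by (auto simp: fractional_ideal_group_def)
  thus ?thesis
    by (simp add: class_number_def ideal_class_group_def FactGroup_def Coset.order_def)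
qed

lemma homothety_class_scale:
  assumes "a \<in> rat_adjoin z" "a \<noteq> 0"
  shows "homothety_class z ((\<lambda>x. a * x) ` I) = homothety_class z I"
proof (intro equalityI subsetI)
  fix S assume "S \<in> homothety_class z ((\<lambda>x. a * x) ` I)"
  then obtain b where "b \<in> rat_adjoin z" "b \<noteq> 0" "S = (\<lambda>x. (b * a) * x) ` I"
    by (auto simp: homothety_class_def image_image mult.assoc)
  thus "S \<in> homothety_class z I"
    using assms unfolding homothety_class_def
    by (intro CollectI exI[of _ "b * a"]) (auto intro: rat_adjoin_mult)
next
  fix S assume "S \<in> homothety_class z I"
  then obtain b where "b \<in> rat_adjoin z" "b \<noteq> 0" "S = (\<lambda>x. b * x) ` I"
    by (auto simp: homothety_class_def)
  thus "S \<in> homothety_class z ((\<lambda>x. a * x) ` I)"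
    using assms unfolding homothety_class_def
    by (intro CollectI exI[of _ "b / a"]) (auto simp: image_image intro: rat_adjoin_divide)
qed

text \<open>Multiplication by the ideal $(s, \theta)$, whose cube is $(\theta)$, permutes the ideal
  classes with order three.\<close>

lemma three_dvd_class_number:
  assumes s: "s \<in> ints z" and \<theta>: "\<theta> \<in> ints z" "\<theta> \<noteq> 0" and \<theta>': "\<theta>' \<in> ints z"
    and norm: "\<theta> * \<theta>' = s ^ 3"
    and A: "A \<in> ints z" and B: "B \<in> ints z"
    and bezout: "A * (\<theta> + \<theta>') ^ 2 + B * s ^ 2 = 1"
    and nofix: "\<And>I c. I \<in> fractional_ideals (rat_adjoin z) \<Longrightarrow> c \<in> rat_adjoin z \<Longrightarrow> c \<noteq> 0 \<Longrightarrow>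
      (\<lambda>x. c ^ 3 * x) ` I \<noteq> (\<lambda>x. \<theta> * x) ` I"
  shows "3 dvd class_number (rat_adjoin z)"
proof -
  let ?K = "rat_adjoin z"
  \<comment> \<open>Multiplication by the ideal generated by \<open>s\<close> and \<theta>. Since
    \<open>I\<close> absorbs integers and is closed under sums, combinations of two terms exhaust
    the product.\<close>
  define f where "f = (\<lambda>I. {s * x + \<theta> * y | x y. x \<in> I \<and> y \<in> I})"
  have fI: "s * x + \<theta> * y \<in> f I" if "x \<in> I" "y \<in> I" for x y I
    using that by (auto simp: f_def)
  have fE: "\<exists>x y. w = s * x + \<theta> * y \<and> x \<in> I \<and> y \<in> I" if "w \<in> f I" for w I
    using that by (auto simp: f_def)
  have f_frac: "f I \<in> fractional_ideals ?K" if I: "I \<in> fractional_ideals ?K" for I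
  proof -
    note I' = I[unfolded fractional_ideals_iff]
    obtain x d where x: "x \<in> I" "x \<noteq> 0" and d: "d \<in> ints z" "d \<noteq> 0" "\<forall>x\<in>I. d * x \<in> ints z"
      using I' by blast
    show ?thesis unfolding fractional_ideals_iff
    proof (intro conjI ballI)
      show "0 \<in> f I" using fI[of 0 I 0] I' by simp
      show "\<exists>x\<in>f I. x \<noteq> 0" using fI[of 0 I x] x \<theta>(2) I' by (intro bexI[of _ "\<theta> * x"]) auto
      fix v w assume "v \<in> f I" "w \<in> f I"
      then obtain x y x' y' where *: "v = s * x + \<theta> * y" "w = s * x' + \<theta> * y'" "x \<in> I" "y \<in> I" "x' \<in> I" "y' \<in> I"
        using fE by meson
      show "v + w \<in> f I" using fI[of "x + x'" I "y + y'"] * I' by (simp add: algebra_simps)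
    next
      fix a w assume a: "a \<in> ints z" and "w \<in> f I"
      then obtain x y where *: "w = s * x + \<theta> * y" "x \<in> I" "y \<in> I" using fE by meson
      show "a * w \<in> f I" using fI[of "a * x" I "a * y"] * I' a by (simp add: algebra_simps)
    next
      have "d * w \<in> ints z" if w: "w \<in> f I" for w
      proof -
        obtain x y where *: "w = s * x + \<theta> * y" "x \<in> I" "y \<in> I" using fE w by meson
        have "s * (d * x) + \<theta> * (d * y) \<in> ints z"
          using * d s \<theta> by (simp add: ints_closed)
        thus ?thesis using * by (simp add: algebra_simps)
      qed
      thus "\<exists>d\<in>ints z. d \<noteq> 0 \<and> (\<forall>x\<in>f I. d * x \<in> ints z)" using d by blast
    qed
  qed
  have f_scale: "f ((\<lambda>x. a * x) ` I) = (\<lambda>x. a * x) ` f I" for a I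
  proof (intro equalityI subsetI)
    fix w assume "w \<in> f ((\<lambda>x. a * x) ` I)"
    then obtain x y where "w = s * (a * x) + \<theta> * (a * y)" "x \<in> I" "y \<in> I" using fE by blast
    thus "w \<in> (\<lambda>x. a * x) ` f I" using fI[of x I y] by (auto simp: algebra_simps intro!: image_eqI)
  next
    fix w assume "w \<in> (\<lambda>x. a * x) ` f I"
    then obtain x y where "w = a * (s * x + \<theta> * y)" "x \<in> I" "y \<in> I" using fE by blast
    moreover from this have "s * (a * x) + \<theta> * (a * y) \<in> f ((\<lambda>x. a * x) ` I)"
      by (intro fI) auto
    ultimately show "w \<in> f ((\<lambda>x. a * x) ` I)" by (simp add: distrib_left mult.left_commute)
  qed
  have f3: "f (f (f I)) = (\<lambda>x. \<theta> * x) ` I" if I: "I \<in> fractional_ideals ?K" for I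
  proof (intro equalityI subsetI)
    have Iadd: "x + y \<in> I" if "x \<in> I" "y \<in> I" for x y using I that by (simp add: fractional_ideals_iff)
    have Imult: "a * x \<in> I" if "a \<in> ints z" "x \<in> I" for a x using I that by (simp add: fractional_ideals_iff)
    {
      fix w assume "w \<in> f (f (f I))"
      then obtain a b c d e g h k where "w = s * (s * (s * a + \<theta> * b) + \<theta> * (s * c + \<theta> * d)) + \<theta> * (s * (s * e + \<theta> * g) + \<theta> * (s * h + \<theta> * k))"
        and mem: "a \<in> I" "b \<in> I" "c \<in> I" "d \<in> I" "e \<in> I" "g \<in> I" "h \<in> I" "k \<in> I"
        using fE by metis
      \<comment> \<open>Collecting the eight terms leaves the generators s^3, s^2 \<theta>, s
        \<theta>^2, \<theta>^3; the first equals \<theta> \<theta>', so all are divisible by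
        \<theta>.\<close>
      hence "w = (\<theta> * \<theta>') * a + \<theta> * (s^2 * (b + (c + e)) + s * \<theta> * (d + (g + h)) + \<theta>^2 * k)"
        unfolding norm by (simp add: algebra_simps power2_eq_square power3_eq_cube)
      hence "w = \<theta> * (\<theta>' * a + (s^2 * (b + (c + e)) + (s * \<theta> * (d + (g + h)) + \<theta>^2 * k)))"
        by (simp add: algebra_simps)
      moreover have "\<theta>' * a + (s^2 * (b + (c + e)) + (s * \<theta> * (d + (g + h)) + \<theta>^2 * k)) \<in> I"
        by (intro Iadd Imult mem ints_closed ints_power s \<theta> \<theta>')
      ultimately show "w \<in> (\<lambda>x. \<theta> * x) ` I" by blast
    }
    {
      fix w assume "w \<in> (\<lambda>x. \<theta> * x) ` I"
      then obtain x where x: "x \<in> I" "w = \<theta> * x" by auto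
      \<comment> \<open>Multiply the Bezout identity by \<theta> and expand the square: A \<theta>
        (\<theta> + \<theta>')^2 = A \<theta>^3 + \<theta> \<theta>' A (2 \<theta> + \<theta>').
        Here \<theta> \<theta>' = s^3, so three of the four generators suffice.\<close>
      define a where "a = A * (\<theta> + \<theta>' + \<theta>) * x"
      define b where "b = B * x"
      define k where "k = A * x"
      have mem: "a \<in> I" "b \<in> I" "k \<in> I" "0 \<in> I"
        unfolding a_def b_def k_def
        using I by (intro Imult ints_closed A B x \<theta> \<theta>', simp add: fractional_ideals_iff)+
      have "w = \<theta> * (A * (\<theta> + \<theta>') ^ 2 + B * s ^ 2) * x" using x bezout by simp
      also have "\<dots> = (\<theta> * \<theta>') * a + \<theta> * s ^ 2 * b + \<theta> ^ 3 * k"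
        by (simp add: a_def b_def k_def power2_eq_square power3_eq_cube algebra_simps)
      also have "\<dots> = s * (s * (s * a + \<theta> * b) + \<theta> * (s * 0 + \<theta> * 0)) + \<theta> * (s * (s * 0 + \<theta> * 0) + \<theta> * (s * 0 + \<theta> * k))"
        unfolding norm by (simp add: power2_eq_square power3_eq_cube algebra_simps)
      also have "\<dots> \<in> f (f (f I))" by (intro fI mem)
      finally show "w \<in> f (f (f I))" .
    }
  qed
  have f_class: "image f (homothety_class z I) = homothety_class z (f I)" for I
    by (simp add: homothety_class_def setcompr_eq_image image_image f_scale)
  show ?thesis
  proof (cases "finite (homothety_class z ` fractional_ideals ?K)")
    case True
    have \<theta>K: "\<theta> \<in> ?K" using \<theta> by (simp add: ints_iff)
    have "3 dvd card (homothety_class z ` fractional_ideals ?K)"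
    proof (rule three_dvd_card_if_order_three[OF True, of "image f"])
      fix S assume "S \<in> homothety_class z ` fractional_ideals ?K"
      then obtain I where I: "I \<in> fractional_ideals ?K" "S = homothety_class z I" by auto
      show "f ` S \<in> homothety_class z ` fractional_ideals ?K"
        using I f_frac by (simp add: f_class)
      show "f ` f ` f ` S = S"
        by (simp add: f_class f3 I homothety_class_scale \<theta> \<theta>K)
      show "f ` S \<noteq> S"
      proof
        assume "f ` S = S"
        hence eq: "homothety_class z (f I) = homothety_class z I" using I by (simp add: f_class)
        have "f I \<in> homothety_class z (f I)" unfolding homothety_class_def
          by (intro CollectI exI[of _ 1]) (simp add: rat_adjoin_1)
        then obtain c where c: "c \<in> ?K" "c \<noteq> 0" "f I = (\<lambda>x. c * x) ` I"
          unfolding eq by (auto simp: homothety_class_def)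
        \<comment> \<open>Applying \<open>f\<close> three times to I multiplies it by c^3 on one
          hand and by \<theta> on the other.\<close>
        have "(\<lambda>x. \<theta> * x) ` I = (\<lambda>x. c ^ 3 * x) ` I"
          unfolding f3[OF I(1), symmetric] c(3) f_scale
          by (simp add: image_image power3_eq_cube mult.assoc)
        thus False using nofix[OF I(1) c(1,2)] by simp
      qed
    qed
    thus ?thesis by (simp add: class_number_eq)
  qed (simp add: class_number_eq)
qed

subsection \<open>Units and cube roots in cyclotomic fields\<close>

text \<open>The product of the X - z^k equals 1 + X + ... + X^(n-1): both sides have the same
  coefficient at X^(n-1) and vanish at the same n - 1 points. The claim is the value at 1.\<close>

lemma prod_one_minus_roots_of_unity:
  assumes "primitive_root_of_unity n z"
  shows "(\<Prod>k\<in>{1..<n}. 1 - z ^ k) = of_nat n"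
proof -
  have n: "n > 0" "z ^ n = 1" "\<And>k. 0 < k \<Longrightarrow> k < n \<Longrightarrow> z ^ k \<noteq> 1"
    using assms by (auto simp: primitive_root_of_unity_def)
  define P where "P = (\<Prod>k\<in>{1..<n}. [:- (z ^ k), 1:])"
  define Q where "Q = (\<Sum>i<n. monom (1::complex) i)"
  have inj: "inj_on (\<lambda>k. z ^ k) {1..<n}"
    using primitive_root_of_unity_powers(1)[OF assms] by (rule inj_on_subset) auto
  have degP: "degree P = n - 1"
    unfolding P_def by (subst degree_prod_eq_sum_degree) auto
  have "P = Q"
  proof (rule poly_eqI_degree_lead_coeff)
    have "lead_coeff P = 1" by (simp add: P_def lead_coeff_prod)
    moreover have "coeff Q (n - 1) = 1"
      using n(1) by (simp add: Q_def coeff_sum)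
    ultimately show "coeff P (n - 1) = coeff Q (n - 1)" by (simp add: degP)
    show "n - 1 \<le> card ((\<lambda>k. z ^ k) ` {1..<n})" using inj by (simp add: card_image)
    show "degree P \<le> n - 1" by (simp add: degP)
    show "degree Q \<le> n - 1" unfolding Q_def
      by (rule degree_sum_le) (auto intro: order.trans[OF degree_monom_le])
    fix w assume "w \<in> (\<lambda>k. z ^ k) ` {1..<n}"
    then obtain k where "k \<in> {1..<n}" and "w = z ^ k" by blast
    hence k: "0 < k" "k < n" "w = z ^ k" by simp_all
    have "w ^ n = (z ^ n) ^ k" by (simp add: k mult.commute flip: power_mult)
    hence "w ^ n = 1" by (simp add: n)
    hence "(w - 1) * (\<Sum>i<n. w ^ i) = 0" by (simp flip: power_diff_1_eq)
    hence "poly Q w = 0" using k n(3) by (simp add: Q_def poly_sum poly_monom)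
    moreover have "poly P w = 0" using k by (auto simp: P_def poly_prod intro!: bexI[of _ k])
    ultimately show "poly P w = poly Q w" by simp
  qed
  hence "poly P 1 = poly Q 1" by simp
  thus ?thesis by (simp add: P_def Q_def poly_prod poly_sum poly_monom)
qed

text \<open>In the product of the $1 - z^k$ the factors of index $k$ and $n - k$ combine to
  $-z^{-k} (1 - z^k)^2$, and $z^{-k} = (z^{kh})^2$ for $n = 2h + 1$.\<close>

lemma sqrt_in_cyclotomic_field:
  assumes z: "primitive_root_of_unity (2 * h + 1) z" and zK: "z \<in> rat_adjoin \<zeta>"
  obtains W where "W \<in> rat_adjoin \<zeta>" "W ^ 2 = (-1) ^ h * of_nat (2 * h + 1)"
proof -
  have zn: "z ^ (2 * h + 1) = 1" using z by (simp add: primitive_root_of_unity_def)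
  define W where "W = (\<Prod>k\<in>{1..h}. z ^ (k * h) * (1 - z ^ k))"
  have "of_nat (2 * h + 1) = (\<Prod>k\<in>{1..<2 * h + 1}. 1 - z ^ k)"
    using prod_one_minus_roots_of_unity[OF z] by simp
  also have "{1..<2 * h + 1} = {1..h} \<union> {h+1..2 * h}" by auto
  also have "(\<Prod>k\<in>\<dots>. 1 - z ^ k) = (\<Prod>k\<in>{1..h}. 1 - z ^ k) * (\<Prod>k\<in>{h+1..2 * h}. 1 - z ^ k)"
    by (rule prod.union_disjoint) auto
  also have "(\<Prod>k\<in>{h+1..2 * h}. 1 - z ^ k) = (\<Prod>k\<in>{1..h}. 1 - z ^ (2 * h + 1 - k))"
    by (rule prod.reindex_bij_witness[of _ "\<lambda>k. 2 * h + 1 - k" "\<lambda>k. 2 * h + 1 - k"]) auto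
  also have "(\<Prod>k\<in>{1..h}. 1 - z ^ k) * \<dots> = (\<Prod>k\<in>{1..h}. (1 - z ^ k) * (1 - z ^ (2 * h + 1 - k)))"
    by (rule prod.distrib[symmetric])
  also have "\<dots> = (\<Prod>k\<in>{1..h}. - ((z ^ (k * h) * (1 - z ^ k)) ^ 2))"
  proof (rule prod.cong[OF refl])
    fix k assume k: "k \<in> {1..h}"
    define a where "a = z ^ k"
    define b where "b = z ^ (2 * h + 1 - k)"
    have ab: "a * b = 1" using k zn by (simp add: a_def b_def flip: power_add)
    have "a * (z ^ (k * h)) ^ 2 = (z ^ (2 * h + 1)) ^ k"
      by (simp add: a_def algebra_simps flip: power_mult power_add)
    hence "a * (z ^ (k * h)) ^ 2 = a * b" using zn ab by simp
    hence "(z ^ (k * h)) ^ 2 = b" using ab by (metis mult_cancel_left mult_zero_left zero_neq_one)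
    moreover have "(1 - a) * (1 - b) = - (b * (1 - a) ^ 2)"
    proof -
      have "b * (1 - a) ^ 2 = b - 2 * (a * b) + a * (a * b)"
        by (simp add: power2_eq_square algebra_simps)
      moreover have "(1 - a) * (1 - b) = 1 - a - b + a * b" by (simp add: algebra_simps)
      ultimately show ?thesis by (simp add: ab)
    qed
    ultimately show "(1 - z ^ k) * (1 - z ^ (2 * h + 1 - k)) = - ((z ^ (k * h) * (1 - z ^ k)) ^ 2)"
      unfolding a_def[symmetric] b_def[symmetric] by (simp only: power_mult_distrib)
  qed
  also have "\<dots> = (-1) ^ h * W ^ 2"
    by (simp only: W_def prod_uminus prod_power_distrib card_atLeastAtMost) simp
  finally have "(-1) ^ h * of_nat (2 * h + 1) = ((-1) ^ h * (-1) ^ h) * W ^ 2"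
    by (simp only: mult.assoc)
  hence "W ^ 2 = (-1) ^ h * of_nat (2 * h + 1)" by (simp flip: power_mult_distrib)
  moreover have "W \<in> rat_adjoin \<zeta>"
    unfolding W_def by (intro rat_adjoin_prod rat_adjoin_closed zK)
  ultimately show ?thesis using that by blast
qed

text \<open>The three linear factors multiply to a^3 - b^3 up to an explicit multiple of \<omega>^2
  + \<omega> + 1.\<close>

lemma cube_roots:
  assumes "\<omega> ^ 2 + \<omega> + 1 = 0" "(a :: complex) ^ 3 = b ^ 3"
  shows "a = b \<or> a = \<omega> * b \<or> a = \<omega> ^ 2 * b"
proof -
  have "(a - b) * (a - \<omega> * b) * (a - \<omega> ^ 2 * b) = a ^ 3 - b ^ 3 +
      (\<omega> ^ 2 + \<omega> + 1) * ((\<omega> - 1) * (a * b ^ 2 - b ^ 3) - a ^ 2 * b + a * b ^ 2)"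
    by (simp add: algebra_simps power2_eq_square power3_eq_cube)
  thus ?thesis using assms by simp
qed

section \<open>Multipliers that stabilise a fractional ideal, and cube roots\<close>

context cyclotomic
begin

lemma rat_adjoin_subset_L:
  assumes "z \<in> L"
  shows "rat_adjoin z \<subseteq> L"
proof
  fix x assume "x \<in> rat_adjoin z"
  hence "x \<in> generate_field CC {z}" by (simp add: rat_adjoin_def)
  thus "x \<in> L"
    by induction (use assms in \<open>auto simp: CC_m_inv intro: L_1 L_add L_mult L_minus L_inverse\<close>)
qed

text \<open>For x in I with denominator d, both d u^n x and d x / u^n are algebraic integers. The
  first times the conjugate of the second is v w^n, where v = d x cnj (d x) and w = u / cnj u. Since
  \<sigma> commutes with conjugation, the conjugates of w have absolute value 1. So the v w^n form a
  finite set and two powers of w agree.\<close>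

lemma stabilizer_root_of_unity:
  assumes I: "I \<in> fractional_ideals (rat_adjoin \<eta>)" and u: "u \<in> rat_adjoin \<eta>" "u \<noteq> 0"
    and eq: "(\<lambda>x. u * x) ` I = I"
  obtains M where "M > 0" "(u / cnj u) ^ M = 1"
proof -
  have KL: "rat_adjoin \<eta> \<subseteq> L" using rat_adjoin_subset_L[OF L_eta] .
  obtain x d where x: "x \<in> I" "x \<noteq> 0" and d: "d \<in> ints \<eta>" "d \<noteq> 0" "\<And>x. x \<in> I \<Longrightarrow> d * x \<in> ints \<eta>"
    using I unfolding fractional_ideals_iff by blast
  have up: "u ^ n * x \<in> I" for n
    by (induction n) (use x eq in \<open>auto simp: mult.assoc\<close>)
  have down: "x / u ^ n \<in> I" for n
  proof (induction n)
    case (Suc n)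
    then obtain y where "y \<in> I" "x / u ^ n = u * y" using eq by (metis imageE)
    thus ?case using u(2) by (simp add: field_simps)
  qed (use x in simp)
  define v where "v = d * x * cnj (d * x)"
  define w where "w = u / cnj u"
  have L: "u \<in> L" "d * x \<in> L"
    using KL u d(3)[OF x(1)] by (auto simp: ints_iff)
  have wL: "w \<in> L" and vL: "v \<in> L" unfolding w_def v_def by (intro L_divide L_mult L_cnj L)+
  have v0: "v \<noteq> 0" using d(2) x(2) by (simp add: v_def)
  define C where "C = Max ((\<lambda>r. cmod (\<sigma> r v)) ` conjs)"
  have "algebraic_int (v * w ^ n)" for n
  proof -
    have "algebraic_int (d * (u ^ n * x))" "algebraic_int (d * (x / u ^ n))"
      using d(3)[OF up] d(3)[OF down] by (simp_all add: ints_iff)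
    hence "algebraic_int (d * (u ^ n * x) * cnj (d * (x / u ^ n)))"
      by (rule algebraic_int_times[OF _ algebraic_int_cnj])
    thus ?thesis by (simp add: v_def w_def power_divide mult_ac)
  qed
  moreover have "cmod (\<sigma> r (v * w ^ n)) \<le> C" if r: "r \<in> conjs" for r n
  proof -
    have "\<sigma> r u \<noteq> 0" using \<sigma>_nz[OF r L(1) u(2)] .
    hence "cmod (\<sigma> r w) = 1"
      using r L by (simp add: w_def \<sigma>_divide L_cnj \<sigma>_cnj norm_divide)
    hence "cmod (\<sigma> r (v * w ^ n)) = cmod (\<sigma> r v)"
      using r vL wL by (simp add: \<sigma>_mult \<sigma>_power L_power norm_mult norm_power)
    thus ?thesis unfolding C_def using r finite_conjs by (simp add: Max_ge)
  qed
  ultimately have "range (\<lambda>n. v * w ^ n) \<subseteq>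
      {x \<in> L. algebraic_int x \<and> (\<forall>r\<in>conjs. cmod (\<sigma> r x) \<le> C)}"
    using vL wL by (auto intro: L_mult L_power)
  hence "finite (range (\<lambda>n. v * w ^ n))"
    using finite_bounded_algebraic_ints finite_subset by blast
  hence "\<not> inj (\<lambda>n. v * w ^ n)" using finite_imageD infinite_UNIV_nat by blast
  then obtain i j where "i \<noteq> j" "w ^ i = w ^ j" using v0 by (auto simp: inj_def)
  then obtain i j where ij: "i < j" "w ^ i = w ^ j" by (metis linorder_neqE_nat)
  have "w ^ j = w ^ i * w ^ (j - i)"
    using power_add[of w i "j - i"] ij(1) by simp
  moreover have "w \<noteq> 0" using u by (simp add: w_def)
  ultimately have "w ^ (j - i) = 1" using ij(2) by simp
  thus ?thesis using that[of "j - i"] ij(1) by (simp add: w_def)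
qed

text \<open>The group of the \<sigma> r is commutative. An element that fixes \<gamma> and inverts \<omega>
  singles out one of the three cube roots of \<gamma>; by commutativity every conjugation then
  preserves this choice up to complex conjugation.\<close>

lemma rational_trace_of_cube_root:
  assumes \<omega>: "\<omega> \<in> L" "\<omega> ^ 2 + \<omega> + 1 = 0" and \<delta>: "\<delta> \<in> L" "\<delta> ^ 3 = \<gamma>" and \<gamma>: "cmod \<gamma> = 1" "\<gamma> + cnj \<gamma> \<in> \<rat>"
    and irrational: "(\<gamma> - cnj \<gamma>) * (\<omega> - cnj \<omega>) \<notin> \<rat>"
  obtains \<delta>' where "\<delta>' ^ 3 = \<gamma>" "cmod \<delta>' = 1" "\<delta>' + cnj \<delta>' \<in> \<rat>"
proof -
  have \<gamma>L: "\<gamma> \<in> L" using \<delta> L_power by blast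
  have \<gamma>\<gamma>: "\<gamma> * cnj \<gamma> = 1" using \<gamma>(1) by (simp add: complex_norm_square[symmetric])
  have \<omega>3: "\<omega> ^ 3 = 1"
  proof -
    have "\<omega> ^ 3 - 1 = (\<omega> - 1) * (\<omega> ^ 2 + \<omega> + 1)"
      by (simp add: algebra_simps power2_eq_square power3_eq_cube)
    thus ?thesis using \<omega>(2) by simp
  qed
  have c\<omega>: "cnj \<omega> = \<omega> ^ 2"
  proof -
    have "cmod \<omega> = 1" using power_eq_1_iff[OF \<omega>3] by simp
    hence "\<omega> * cnj \<omega> = 1" by (simp add: complex_norm_square[symmetric])
    moreover have "\<omega> * \<omega> ^ 2 = 1" using \<omega>3 by (simp add: power3_eq_cube power2_eq_square mult.assoc)
    ultimately show ?thesis by (metis mult_cancel_left mult_zero_left zero_neq_one)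
  qed
  have \<omega>neq: "\<omega> \<noteq> cnj \<omega>" using irrational by auto
  \<comment> \<open>The elements \<gamma> and \<open>cnj \<gamma>\<close> are the roots of a
    quadratic polynomial with rational coefficients and constant term 1.\<close>
  have conj_\<gamma>: "\<sigma> r \<gamma> = \<gamma> \<or> \<sigma> r \<gamma> = cnj \<gamma>" if r: "r \<in> conjs" for r
  proof -
    obtain a where a: "\<gamma> + cnj \<gamma> = of_rat a" using \<gamma>(2) by (auto elim: Rats_cases)
    have "\<sigma> r \<gamma> + \<sigma> r (cnj \<gamma>) = \<gamma> + cnj \<gamma>"
      using \<sigma>_add[OF r \<gamma>L L_cnj[OF \<gamma>L]] \<sigma>_rat[OF r] a by simp
    moreover have "\<sigma> r \<gamma> * \<sigma> r (cnj \<gamma>) = \<gamma> * cnj \<gamma>"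
      using \<sigma>_mult[OF r \<gamma>L L_cnj[OF \<gamma>L]] \<sigma>_1[OF r] \<gamma>\<gamma> by simp
    moreover have "(\<sigma> r \<gamma> - \<gamma>) * (\<sigma> r \<gamma> - cnj \<gamma>) =
        \<sigma> r \<gamma> * (\<sigma> r \<gamma> - (\<gamma> + cnj \<gamma>)) + \<gamma> * cnj \<gamma>"
      by (simp add: algebra_simps)
    ultimately have "(\<sigma> r \<gamma> - \<gamma>) * (\<sigma> r \<gamma> - cnj \<gamma>) =
        \<sigma> r \<gamma> * (\<sigma> r \<gamma> - (\<sigma> r \<gamma> + \<sigma> r (cnj \<gamma>))) + \<sigma> r \<gamma> * \<sigma> r (cnj \<gamma>)"
      by simp
    also have "\<dots> = 0" by (simp add: algebra_simps)
    finally show ?thesis by simp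
  qed
  have conj_\<omega>: "\<sigma> r \<omega> = \<omega> \<or> \<sigma> r \<omega> = cnj \<omega>" if r: "r \<in> conjs" for r
  proof -
    have "(\<sigma> r \<omega>) ^ 3 = 1 ^ 3" using \<sigma>_power[OF r \<omega>(1), of 3] \<sigma>_1[OF r] \<omega>3 by simp
    hence "\<sigma> r \<omega> = 1 \<or> \<sigma> r \<omega> = \<omega> \<or> \<sigma> r \<omega> = cnj \<omega>"
      using cube_roots[OF \<omega>(2), of "\<sigma> r \<omega>" 1] by (simp add: c\<omega>)
    moreover have "\<sigma> r \<omega> \<noteq> 1"
    proof
      assume "\<sigma> r \<omega> = 1"
      hence "\<omega> = 1" using \<sigma>_inj[OF r] \<omega>(1) L_1 \<sigma>_1[OF r] by (auto simp: inj_on_def)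
      thus False using \<omega>neq by simp
    qed
    ultimately show ?thesis by blast
  qed
  \<comment> \<open>An automorphism moving the irrational product negates exactly one of its two
    factors. If it is the factor of \<gamma>, composing with complex conjugation exchanges the
    roles.\<close>
  obtain r where r: "r \<in> conjs" "\<sigma> r \<gamma> = \<gamma>" "\<sigma> r \<omega> = cnj \<omega>"
  proof -
    let ?s = "(\<gamma> - cnj \<gamma>) * (\<omega> - cnj \<omega>)"
    have sL: "?s \<in> L" by (intro L_mult L_diff L_cnj \<gamma>L \<omega>)
    obtain r where r: "r \<in> conjs" "\<sigma> r ?s \<noteq> ?s" using fixed_imp_rat[OF sL] irrational by blast
    have "\<sigma> r ?s = (\<sigma> r \<gamma> - cnj (\<sigma> r \<gamma>)) * (\<sigma> r \<omega> - cnj (\<sigma> r \<omega>))"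
      using r(1) \<gamma>L \<omega>(1) by (simp add: \<sigma>_mult \<sigma>_diff \<sigma>_cnj L_cnj L_diff)
    with r(2) have *: "(\<sigma> r \<gamma> - cnj (\<sigma> r \<gamma>)) * (\<sigma> r \<omega> - cnj (\<sigma> r \<omega>)) \<noteq> ?s" by simp
    consider "\<sigma> r \<gamma> = \<gamma>" "\<sigma> r \<omega> = cnj \<omega>" | "\<sigma> r \<gamma> = cnj \<gamma>" "\<sigma> r \<omega> = \<omega>"
      using conj_\<gamma>[OF r(1)] conj_\<omega>[OF r(1)] * by (auto simp: algebra_simps)
    thus thesis
    proof cases
      case 1
      thus ?thesis using that r(1) by blast
    next
      case 2
      have "\<sigma> (\<sigma> (cnj \<eta>) r) x = cnj (\<sigma> r x)" if "x \<in> L" for x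
        using \<sigma>_\<sigma>[OF cnj_eta_conjs r(1) that] \<sigma>_cnj_eta[OF \<sigma>_closed[OF r(1) that]] by simp
      thus ?thesis
        using that[of "\<sigma> (cnj \<eta>) r"] \<sigma>_conjs[OF cnj_eta_conjs r(1)] 2 \<gamma>L \<omega>(1) by simp
    qed
  qed
  \<comment> \<open>The automorphism sends \<delta> to \<omega>^j \<delta> and squares \<omega>;
    hence it fixes \<omega>^(2j) \<delta>, with the exponent read modulo 3.\<close>
  obtain \<delta>' where \<delta>': "\<delta>' \<in> L" "\<delta>' ^ 3 = \<gamma>" "\<sigma> r \<delta>' = \<delta>'"
  proof -
    have "\<sigma> r \<delta> ^ 3 = \<delta> ^ 3" using \<sigma>_power[OF r(1) \<delta>(1), of 3] \<delta>(2) r(2) by simp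
    from cube_roots[OF \<omega>(2) this]
    consider "\<sigma> r \<delta> = \<delta>" | "\<sigma> r \<delta> = \<omega> * \<delta>" | "\<sigma> r \<delta> = \<omega> ^ 2 * \<delta>" by blast
    thus thesis
    proof cases
      case 1
      thus ?thesis using that \<delta> by blast
    next
      case 2
      have "\<sigma> r (\<omega> ^ 2 * \<delta>) = (\<omega> ^ 2) ^ 2 * (\<omega> * \<delta>)"
        using r(1,3) \<omega>(1) \<delta>(1) 2 by (simp add: \<sigma>_mult \<sigma>_power L_power c\<omega>)
      also have "\<dots> = \<omega> ^ 3 * (\<omega> ^ 2 * \<delta>)" by (simp add: power2_eq_square power3_eq_cube)
      finally show ?thesis
        using that[of "\<omega> ^ 2 * \<delta>"] \<omega> \<delta> \<omega>3 power_mult[of \<omega> 3 2]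
        by (simp add: L_mult L_power power_mult_distrib)
    next
      case 3
      have "\<sigma> r (\<omega> * \<delta>) = \<omega> ^ 2 * (\<omega> ^ 2 * \<delta>)"
        using r(1,3) \<omega>(1) \<delta>(1) 3 by (simp add: \<sigma>_mult L_power c\<omega>)
      also have "\<dots> = \<omega> ^ 3 * (\<omega> * \<delta>)" by (simp add: power2_eq_square power3_eq_cube)
      finally show ?thesis
        using that[of "\<omega> * \<delta>"] \<omega> \<delta> \<omega>3 by (simp add: L_mult power_mult_distrib)
    qed
  qed
  have norm: "cmod \<delta>' = 1"
  proof -
    have "cmod \<delta>' ^ 3 = 1" using \<delta>'(2) \<gamma>(1) by (metis norm_power)
    from power_eq_1_iff[OF this] show ?thesis by simp
  qed
  hence nz: "\<delta>' \<noteq> 0" by auto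
  \<comment> \<open>Uniqueness: if b is fixed, the automorphism exchanges the other two cube roots
    \<omega> b and \<omega>^2 b.\<close>
  have only: "e = b" if e: "e ^ 3 = b ^ 3" "\<sigma> r e = e" "\<sigma> r b = b" "b \<in> L" "b \<noteq> 0" for e b
  proof -
    have "\<sigma> r (\<omega> * b) = cnj \<omega> * b" "\<sigma> r (\<omega> ^ 2 * b) = cnj \<omega> ^ 2 * b"
      using r(1,3) \<omega>(1) that by (simp_all add: \<sigma>_mult \<sigma>_power L_power)
    moreover have "cnj \<omega> ^ 2 = \<omega>" unfolding c\<omega>
      using \<omega>3 by (simp add: power2_eq_square power3_eq_cube mult.assoc)
    ultimately show ?thesis
      using cube_roots[OF \<omega>(2) e(1)] that(2,5) \<omega>neq c\<omega> by auto
  qed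
  have "\<delta>' + cnj \<delta>' \<in> \<rat>"
  proof (rule fixed_imp_rat)
    show "\<delta>' + cnj \<delta>' \<in> L" by (intro L_add L_cnj \<delta>')
    fix q assume q: "q \<in> conjs"
    let ?e = "\<sigma> q \<delta>'"
    \<comment> \<open>By commutativity the image of \<delta>' is again fixed, and its cube is
      \<gamma> or \<open>cnj \<gamma>\<close>. Uniqueness leaves only \<delta>' and
      \<open>cnj \<delta>'\<close>.\<close>
    have e: "\<sigma> r ?e = ?e" using \<sigma>_commute[OF r(1) q \<delta>'(1)] \<delta>'(3) by simp
    have e3: "?e ^ 3 = \<sigma> q \<gamma>" using \<sigma>_power[OF q \<delta>'(1), of 3] \<delta>'(2) by simp
    have c: "cnj \<delta>' ^ 3 = cnj \<gamma>" "\<sigma> r (cnj \<delta>') = cnj \<delta>'"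
      using \<delta>' \<sigma>_cnj[OF r(1)] by (simp_all flip: complex_cnj_power)
    have "?e = \<delta>' \<or> ?e = cnj \<delta>'"
      using conj_\<gamma>[OF q] only[of ?e \<delta>'] only[of ?e "cnj \<delta>'"] e e3 c \<delta>' nz by (auto simp: L_cnj)
    moreover have "\<sigma> q (\<delta>' + cnj \<delta>') = ?e + cnj ?e"
      using q \<delta>' by (simp add: \<sigma>_add \<sigma>_cnj L_cnj)
    ultimately show "\<sigma> q (\<delta>' + cnj \<delta>') = \<delta>' + cnj \<delta>'" by auto
  qed
  thus ?thesis using that \<delta>' norm by blast
qed

end

subsection \<open>The ideal class of order three\<close>

lemma primitive_root_of_unity_cis:
  assumes "n > 0"
  shows "primitive_root_of_unity n (cis (2 * pi / n))"
proof -
  have pow: "cis (2 * pi / n) ^ k = cis (2 * pi * real k / real n)" for k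
    by (simp add: Complex.DeMoivre mult_ac)
  have "cis (2 * pi / n) ^ k \<noteq> 1" if "0 < k" "k < n" for k
  proof
    assume "cis (2 * pi / n) ^ k = 1"
    hence "cis (2 * pi * real k / real n) = cis (2 * pi * real 0 / real n)" by (simp add: pow)
    hence "k = 0"
      using inj_onD[OF bij_betw_imp_inj_on[OF bij_betw_roots_unity[OF assms]], of k 0] that by simp
    thus False using that by simp
  qed
  thus ?thesis using assms pow[of n] by (simp add: primitive_root_of_unity_def)
qed

lemma unit_square_times:
  fixes a b :: int
  assumes "a ^ 2 * b = 7"
  shows "a = 1 \<or> a = -1"
proof -
  have dvd: "a ^ 2 dvd 7" using assms by (metis dvd_triv_left)
  hence "\<bar>a\<bar> ^ 2 < 3 ^ 2" using zdvd_imp_le[of "a ^ 2" 7] by simp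
  hence "\<bar>a\<bar> < 3" by (rule power2_less_imp_less) simp
  hence "a = 0 \<or> a = 1 \<or> a = -1 \<or> a = 2 \<or> a = -2" by linarith
  thus ?thesis using dvd by auto
qed

theorem theorem3:
  fixes l m :: nat and \<zeta> :: complex
  assumes "odd l"
    and "l > 0"
    and "\<not> [l = 1] (mod 7)"
    and "m = 3000564 * l ^ 3 + 5000940 * l ^ 2 + 2778300 * l + 507297"
    and "primitive_root_of_unity (4 * m) \<zeta>"
  shows "3 dvd class_number (rat_adjoin \<zeta>)"
proof -
  let ?K = "rat_adjoin \<zeta>"
  define t where "t = 9 * int l + 5"
  \<comment> \<open>D = T^2 - 4 t^6 is the discriminant of X^2 - T X + t^6, the polynomial whose
    roots are \<theta> and its conjugate.\<close>
  define D where "D = 49 - 28 * t ^ 3"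
  define T where "T = 7 - 2 * t ^ 3"
  have m: "int m = 1029 * (4 * t ^ 3 - 7)"
    unfolding assms(4) t_def by (simp add: algebra_simps power2_eq_square power3_eq_cube)
  have "t \<ge> 14" using assms(2) by (simp add: t_def)
  have "odd m" unfolding assms(4) by simp
  have "m > 0" unfolding assms(4) by simp
  \<comment> \<open>Modulo 7, 9 l + 5 equals 2 (l - 1).\<close>
  have t7: "\<not> 7 dvd t"
  proof
    assume "7 dvd t"
    hence "(9 * int l + 5) mod 7 = 0" unfolding t_def by simp
    hence "int l mod 7 = 1" by presburger
    hence "l mod 7 = 1" by presburger
    thus False using assms(3) by (simp add: cong_def)
  qed
  have cop: "coprime T t"
  proof -
    have "coprime 7 t" using t7 prime_imp_coprime[of 7 t] by simp
    moreover have "gcd T t = gcd 7 t"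
      using gcd_add_mult[of t "- 2 * t ^ 2" 7] by (simp add: T_def gcd.commute power3_eq_cube power2_eq_square algebra_simps)
    ultimately show ?thesis by (simp add: coprime_iff_gcd_eq_1)
  qed
  have "t ^ 3 \<ge> 14 ^ 3" using \<open>t \<ge> 14\<close> by (intro power_mono) auto
  hence Dneg: "D < 0" by (simp add: D_def)

  have \<zeta>: "\<zeta> ^ (4 * m) = 1" "\<And>k. 0 < k \<Longrightarrow> k < 4 * m \<Longrightarrow> \<zeta> ^ k \<noteq> 1"
    using assms(5) by (auto simp: primitive_root_of_unity_def)
  define \<i>' where "\<i>' = \<zeta> ^ m"
  have i2: "\<i>' ^ 2 = -1"
  proof -
    have "(\<i>' ^ 2) ^ 2 = 1" using \<zeta>(1) by (simp add: \<i>'_def mult.commute flip: power_mult)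
    moreover have "\<i>' ^ 2 \<noteq> 1"
      using \<zeta>(2)[of "m * 2"] \<open>m > 0\<close> by (simp add: \<i>'_def flip: power_mult)
    ultimately show ?thesis using power2_eq_1_iff by blast
  qed
  define \<omega> where "\<omega> = \<zeta> ^ (4 * m div 3)"
  have "3 dvd m"
  proof -
    have "3 dvd int m" unfolding m by simp
    thus ?thesis by presburger
  qed
  hence m3: "4 * m div 3 * 3 = 4 * m" by simp
  have \<omega>: "\<omega> ^ 2 + \<omega> + 1 = 0"
  proof -
    have "\<omega> ^ 3 = 1" using \<zeta>(1) m3 by (simp add: \<omega>_def flip: power_mult)
    moreover have "\<omega> \<noteq> 1" unfolding \<omega>_def by (rule \<zeta>(2)) (use m3 \<open>m > 0\<close> in linarith)+
    moreover have "(\<omega> - 1) * (\<omega> ^ 2 + \<omega> + 1) = \<omega> ^ 3 - 1"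
      by (simp add: algebra_simps power2_eq_square power3_eq_cube)
    ultimately show ?thesis by simp
  qed
  have \<omega>d: "(2 * \<omega> + 1) ^ 2 = -3"
  proof -
    have "(2 * \<omega> + 1) ^ 2 = 4 * (\<omega> ^ 2 + \<omega> + 1) - 3"
      by (simp add: algebra_simps power2_eq_square)
    thus ?thesis using \<omega> by simp
  qed
  \<comment> \<open>As m is odd, \<zeta>^4 is a primitive m-th root of unity, which yields a square
    root of m or of -m; the square root \<open>\<i>'\<close> of -1 corrects the sign.\<close>
  obtain W where W: "W \<in> ?K" "W ^ 2 = of_nat m"
  proof -
    obtain h where h: "m = 2 * h + 1" using \<open>odd m\<close> by (rule oddE)
    have "primitive_root_of_unity (2 * h + 1) (\<zeta> ^ 4)"
      unfolding primitive_root_of_unity_def h[symmetric]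
    proof (intro conjI allI impI)
      show "(\<zeta> ^ 4) ^ m = 1" using \<zeta>(1) by (simp add: power_mult)
      fix k assume k: "0 < k \<and> k < m"
      hence "\<zeta> ^ (4 * k) \<noteq> 1" by (intro \<zeta>(2)) auto
      thus "(\<zeta> ^ 4) ^ k \<noteq> 1" by (simp add: power_mult)
    qed fact
    then obtain V where V: "V \<in> ?K" "V ^ 2 = (-1) ^ h * of_nat m"
      using sqrt_in_cyclotomic_field[of h "\<zeta> ^ 4" \<zeta>] h rat_adjoin_power[OF rat_adjoin_self] by metis
    show thesis
    proof (cases "even h")
      case True
      thus ?thesis using V that by simp
    next
      case False
      have "\<i>' * V \<in> ?K" unfolding \<i>'_def using V by (intro rat_adjoin_closed)
      moreover have "(\<i>' * V) ^ 2 = of_nat m" using V False i2 by (simp add: power_mult_distrib)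
      ultimately show ?thesis using that by blast
    qed
  qed
  \<comment> \<open>The divisor has square 49 * (-3) = -147, and -m / 147 = 7 (7 - 4 t^3) =
    D.\<close>
  define q where "q = W / (7 * (2 * \<omega> + 1))"
  have qK: "q \<in> ?K" unfolding q_def \<omega>_def by (intro rat_adjoin_closed W)
  have q2: "q ^ 2 = of_int D"
  proof -
    have "q ^ 2 = of_int (int m) / (- 147)"
      unfolding q_def power_divide power_mult_distrib \<omega>d W(2) by simp
    also have "\<dots> = of_int D" unfolding m D_def by (simp add: field_simps)
    finally show ?thesis .
  qed
  \<comment> \<open>Since D is negative, q is purely imaginary.\<close>
  have cq: "cnj q = - q"
  proof -
    have "(cnj q) ^ 2 = q ^ 2" using q2 by (metis complex_cnj_of_int complex_cnj_power)
    moreover have "cnj q \<noteq> q"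
    proof
      assume "cnj q = q"
      then obtain x where "q = of_real x" by (metis Reals_cases Reals_cnj_iff)
      hence "of_real (x ^ 2) = (of_real (of_int D) :: complex)" using q2 by simp
      hence "x ^ 2 = of_int D" by (simp only: of_real_eq_iff)
      moreover have "x ^ 2 \<ge> 0" by simp
      ultimately show False using Dneg by simp
    qed
    ultimately show ?thesis by (simp add: power2_eq_iff)
  qed
  define \<theta> where "\<theta> = (of_int T + q) / 2"
  have c\<theta>: "cnj \<theta> = (of_int T - q) / 2" by (simp add: \<theta>_def cq)
  have tr: "\<theta> + cnj \<theta> = of_int T" unfolding c\<theta> by (simp add: \<theta>_def field_simps)
  have nm: "\<theta> * cnj \<theta> = of_int (t ^ 6)"
  proof -
    have "\<theta> * cnj \<theta> = (of_int T ^ 2 - q ^ 2) / 4"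
      unfolding c\<theta> by (simp add: \<theta>_def field_simps power2_eq_square)
    also have "\<dots> = of_int (T ^ 2 - D) / 4" by (simp add: q2)
    also have "T ^ 2 - D = 4 * t ^ 6"
      by (simp add: T_def D_def power2_eq_square algebra_simps flip: power_add)
    finally show ?thesis by simp
  qed
  have \<theta>_int: "algebraic_int \<theta>"
  proof (rule algebraic_int.intros)
    have "\<theta> ^ 2 - (\<theta> + cnj \<theta>) * \<theta> + \<theta> * cnj \<theta> = 0" by (simp add: algebra_simps power2_eq_square)
    thus "poly [:of_int (t ^ 6), - of_int T, 1:] \<theta> = 0"
      unfolding tr nm by (simp add: algebra_simps power2_eq_square)
  qed (auto simp: coeff_pCons split: nat.splits)
  have \<theta>_ints: "\<theta> \<in> ints \<zeta>" "cnj \<theta> \<in> ints \<zeta>"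
  proof -
    show "\<theta> \<in> ints \<zeta>" unfolding ints_iff
      using \<theta>_int by (auto simp: \<theta>_def intro!: rat_adjoin_closed qK)
    show "cnj \<theta> \<in> ints \<zeta>" unfolding ints_iff
      using algebraic_int_cnj[OF \<theta>_int] by (auto simp: c\<theta> intro!: rat_adjoin_closed qK)
  qed
  have t0: "t \<noteq> 0" using \<open>t \<ge> 14\<close> by simp
  have \<theta>0: "\<theta> \<noteq> 0"
  proof
    assume "\<theta> = 0"
    hence "of_int (t ^ 6) = (0 :: complex)" using nm by simp
    thus False using t0 by simp
  qed
  \<comment> \<open>Coprimality of the trace T and t supplies the identity that makes the cube of
    (t^2, \<theta>) equal to (\<theta>).\<close>
  obtain A B where AB: "A * T ^ 2 + B * (t ^ 2) ^ 2 = 1"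
  proof -
    have "coprime (T ^ 2) ((t ^ 2) ^ 2)" using cop by simp
    thus ?thesis using that bezout_int[of "T ^ 2" "(t ^ 2) ^ 2"] by (auto simp: coprime_iff_gcd_eq_1)
  qed
  show ?thesis
  proof (rule three_dvd_class_number[of "of_int (t ^ 2)" \<zeta> \<theta> "cnj \<theta>" "of_int A" "of_int B"])
    show "\<theta> * cnj \<theta> = of_int (t ^ 2) ^ 3" by (simp add: nm flip: power_mult)
    show "of_int A * (\<theta> + cnj \<theta>) ^ 2 + of_int B * of_int (t ^ 2) ^ 2 = 1"
      unfolding tr using arg_cong[OF AB, of complex_of_int] by simp
    fix I c assume I: "I \<in> fractional_ideals ?K" and c: "c \<in> ?K" "c \<noteq> 0"
    show "(\<lambda>x. c ^ 3 * x) ` I \<noteq> (\<lambda>x. \<theta> * x) ` I"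
    proof
      assume eq: "(\<lambda>x. c ^ 3 * x) ` I = (\<lambda>x. \<theta> * x) ` I"
      interpret K: cyclotomic "4 * m" \<zeta> by standard fact
      define u where "u = c ^ 3 / \<theta>"
      have uK: "u \<in> ?K" unfolding u_def using c \<theta>_ints by (intro rat_adjoin_closed) (simp_all add: ints_iff)
      have u0: "u \<noteq> 0" using c \<theta>0 by (simp add: u_def)
      have "(\<lambda>x. u * x) ` I = (\<lambda>y. y / \<theta>) ` (\<lambda>x. c ^ 3 * x) ` I"
        by (simp add: image_image u_def)
      also have "\<dots> = I" unfolding eq using \<theta>0 by (simp add: image_image)
      finally obtain M where M: "M > 0" "(u / cnj u) ^ M = 1"
        using K.stabilizer_root_of_unity[OF I uK u0] by blast
      define w where "w = u / cnj u"
      \<comment> \<open>The factor 4 m puts \<zeta> into the larger field; the factor 3 M, which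
        together with 4 m makes up N, accommodates a cube root of w, since w^M = 1.\<close>
      define N where "N = 12 * m * M"
      have N: "N > 0" using M \<open>m > 0\<close> by (simp add: N_def)
      define \<eta> where "\<eta> = cis (2 * pi / N)"
      interpret F: cyclotomic N \<eta>
        by standard (use primitive_root_of_unity_cis[OF N] in \<open>simp add: \<eta>_def\<close>)
      have wn: "cmod w = 1" using u0 by (simp add: w_def norm_divide)
      define \<xi> where "\<xi> = cis (Arg w / 3)"
      have \<xi>3: "\<xi> ^ 3 = w"
      proof -
        have "\<xi> ^ 3 = cis (Arg w)" by (simp add: \<xi>_def Complex.DeMoivre)
        thus ?thesis using rcis_cmod_Arg[of w] wn by (simp add: rcis_def)
      qed
      have \<xi>F: "\<xi> \<in> F.L"
      proof (rule F.L_root_of_unity)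
        have "\<xi> ^ N = (\<xi> ^ 3) ^ (M * (4 * m))" by (simp add: N_def mult_ac flip: power_mult)
        also have "\<dots> = 1" unfolding \<xi>3 power_mult using M by (simp add: w_def)
        finally show "\<xi> ^ N = 1" .
      qed
      have "\<zeta> ^ N = (\<zeta> ^ (4 * m)) ^ (3 * M)" by (simp add: N_def mult_ac flip: power_mult)
      hence "\<zeta> \<in> F.L" using \<zeta>(1) by (intro F.L_root_of_unity) simp
      hence KF: "?K \<subseteq> F.L" by (rule F.rat_adjoin_subset_L)
      have \<omega>F: "\<omega> \<in> F.L" using KF by (auto simp: \<omega>_def intro: rat_adjoin_closed)
      define \<gamma> where "\<gamma> = \<theta> / of_int (t ^ 3)"
      have c\<gamma>: "cnj \<gamma> = cnj \<theta> / of_int (t ^ 3)" by (simp add: \<gamma>_def)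
      have tt: "of_int (t ^ 3) \<noteq> (0 :: complex)" using t0 by simp
      have \<gamma>\<gamma>: "\<gamma> * cnj \<gamma> = 1"
        unfolding c\<gamma> using nm t0 by (simp add: \<gamma>_def flip: power_add)
      hence \<gamma>1: "cmod \<gamma> = 1"
        by (metis complex_mod_mult_cnj norm_one power2_eq_1_iff norm_ge_zero not_one_le_zero neg_0_le_iff_le)
      have \<gamma>0: "\<gamma> \<noteq> 0" using \<gamma>1 by auto
      have \<gamma>tr: "\<gamma> + cnj \<gamma> = of_int T / of_int (t ^ 3)"
        unfolding c\<gamma> \<gamma>_def tr[symmetric] by (simp add: add_divide_distrib)
      \<comment> \<open>From u = c^3 / \<theta> and |\<gamma>| = 1 one gets w = (c / cnj c)^3 /
        \<gamma>^2. Hence \<gamma> = \<gamma>^3 w (cnj c / c)^3 is a cube.\<close>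
      define \<delta> where "\<delta> = \<gamma> * \<xi> * cnj c / c"
      have \<delta>3: "\<delta> ^ 3 = \<gamma>"
      proof -
        have "w = (c / cnj c) ^ 3 * (cnj \<theta> / \<theta>)"
          by (simp add: w_def u_def power_divide)
        also have "cnj \<theta> / \<theta> = cnj \<gamma> / \<gamma>" using tt by (simp add: c\<gamma> \<gamma>_def)
        also have "cnj \<gamma> = 1 / \<gamma>" using \<gamma>\<gamma> \<gamma>0 by (simp add: field_simps)
        finally have "w = (c / cnj c) ^ 3 / \<gamma> ^ 2" by (simp add: power2_eq_square)
        moreover have "\<delta> ^ 3 = \<gamma> ^ 3 * w * (cnj c / c) ^ 3"
          by (simp add: \<delta>_def power_divide power_mult_distrib \<xi>3)
        ultimately have "\<delta> ^ 3 = \<gamma> ^ 3 / \<gamma> ^ 2"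
          using c(2) by (simp add: power_divide)
        thus ?thesis using \<gamma>0 by (simp add: power2_eq_square power3_eq_cube)
      qed
      have cF: "c \<in> F.L" "\<theta> \<in> F.L" using KF c \<theta>_ints by (auto simp: ints_iff)
      have \<gamma>F: "\<gamma> \<in> F.L" unfolding \<gamma>_def
        using cF KF rat_adjoin_of_int by (intro F.L_divide) blast+
      have \<delta>F: "\<delta> \<in> F.L" unfolding \<delta>_def
        by (intro F.L_divide F.L_mult F.L_cnj cF \<gamma>F \<xi>F)
      \<comment> \<open>Scaled by t^3 the product becomes q (\<omega> - cnj \<omega>), whose square
        is -3 D = 21 (4 t^3 - 7). If rational it is an integer divisible by 7, so 49 divides its
        square and 7 divides 12 t^3, against \<open>t7\<close>.\<close>
      have irr: "(\<gamma> - cnj \<gamma>) * (\<omega> - cnj \<omega>) \<notin> \<rat>"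
      proof
        define s where "s = of_int (t ^ 3) * ((\<gamma> - cnj \<gamma>) * (\<omega> - cnj \<omega>))"
        assume "(\<gamma> - cnj \<gamma>) * (\<omega> - cnj \<omega>) \<in> \<rat>"
        hence sQ: "s \<in> \<rat>" unfolding s_def by (rule Rats_mult[OF Rats_of_int])
        have "of_int (t ^ 3) * (\<gamma> - cnj \<gamma>) = \<theta> - cnj \<theta>"
          unfolding c\<gamma> \<gamma>_def using tt by (simp add: field_simps)
        also have "\<dots> = q" unfolding c\<theta> by (simp add: \<theta>_def field_simps)
        finally have "s = q * (\<omega> - cnj \<omega>)" unfolding s_def by (simp flip: mult.assoc)
        moreover have "(\<omega> - cnj \<omega>) ^ 2 = -3"
        proof -
          have neq: "\<omega> \<noteq> cnj \<omega>"
          proof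
            assume "\<omega> = cnj \<omega>"
            then obtain x where "\<omega> = of_real x" by (metis Reals_cases Reals_cnj_iff)
            hence "of_real ((2 * x + 1) ^ 2) = (of_real (-3) :: complex)" using \<omega>d by simp
            hence "(2 * x + 1) ^ 2 = -3" by (simp only: of_real_eq_iff)
            moreover have "(2 * x + 1) ^ 2 \<ge> 0" by simp
            ultimately show False by linarith
          qed
          have "(cnj (2 * \<omega> + 1)) ^ 2 = (2 * \<omega> + 1) ^ 2"
            unfolding \<omega>d by (metis \<omega>d complex_cnj_power complex_cnj_minus complex_cnj_numeral)
          hence "cnj (2 * \<omega> + 1) = 2 * \<omega> + 1 \<or> cnj (2 * \<omega> + 1) = - (2 * \<omega> + 1)"
            by (simp only: power2_eq_iff)
          moreover have "cnj (2 * \<omega> + 1) \<noteq> 2 * \<omega> + 1" using neq by auto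
          ultimately have c\<omega>: "cnj (2 * \<omega> + 1) = - (2 * \<omega> + 1)" by blast
          have "cnj \<omega> = (cnj (2 * \<omega> + 1) - 1) / 2" by simp
          hence "cnj \<omega> = (- (2 * \<omega> + 1) - 1) / 2" by (simp only: c\<omega>)
          hence "\<omega> - cnj \<omega> = 2 * \<omega> + 1" by (simp add: field_simps)
          thus ?thesis by (simp only: \<omega>d)
        qed
        ultimately have s2: "s ^ 2 = of_int (-3 * D)" by (simp add: power_mult_distrib q2)
        have "algebraic_int s"
          by (rule algebraic_int_root[of "of_int (-3 * D)" "monom 1 2"])
            (auto simp: poly_monom s2 degree_monom_eq coeff_monom int_imp_algebraic_int simp del: of_int_mult)
        hence "s \<in> \<int>" using sQ by (rule rational_algebraic_int_is_int)
        then obtain k where "s = of_int k" by (auto elim: Ints_cases)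
        hence "of_int (k ^ 2) = (of_int (-3 * D) :: complex)" using s2 by simp
        hence k: "k ^ 2 = -3 * D" by (simp only: of_int_eq_iff)
        hence "k ^ 2 = 7 * (3 * (4 * t ^ 3 - 7))" by (simp add: D_def)
        hence "7 dvd k ^ 2" by simp
        hence "7 dvd k" by (rule prime_dvd_power[rotated]) simp
        then obtain j where "k = 7 * j" by (rule dvdE)
        hence "49 * j ^ 2 = 7 * (3 * (4 * t ^ 3 - 7))"
          using \<open>k ^ 2 = 7 * _\<close> by (simp add: power_mult_distrib)
        hence "12 * t ^ 3 = 7 * (j ^ 2 + 3)" by simp
        hence "7 dvd 12 * t ^ 3" by simp
        hence "7 dvd (12 :: int) \<or> 7 dvd t ^ 3" by (subst prime_dvd_mult_iff[symmetric]) auto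
        hence "7 dvd t ^ 3" by simp
        hence "7 dvd t" by (rule prime_dvd_power[rotated]) simp
        thus False using t7 by simp
      qed
      have "\<gamma> + cnj \<gamma> \<in> \<rat>" unfolding \<gamma>tr by (intro Rats_divide) auto
      from F.rational_trace_of_cube_root[OF \<omega>F \<omega> \<delta>F \<delta>3 \<gamma>1 this irr]
      obtain \<delta>' where \<delta>': "\<delta>' ^ 3 = \<gamma>" "cmod \<delta>' = 1" "\<delta>' + cnj \<delta>' \<in> \<rat>" .
      define y where "y = of_int t * (\<delta>' + cnj \<delta>')"
      have d1: "\<delta>' * cnj \<delta>' = 1" using \<delta>'(2) by (simp add: complex_norm_square[symmetric])
      \<comment> \<open>The factor t clears the denominator: t \<delta>' is a cube root of the
        algebraic integer \<theta>, so the rational number y is an integer.\<close>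
      have "(of_int t * \<delta>') ^ 3 = \<theta>"
        using \<delta>'(1) tt by (simp add: power_mult_distrib \<gamma>_def)
      hence td: "algebraic_int (of_int t * \<delta>')"
        using algebraic_int_root[OF \<theta>_int, of "monom 1 3"]
        by (simp add: poly_monom degree_monom_eq coeff_monom)
      have "y = of_int t * \<delta>' + cnj (of_int t * \<delta>')" by (simp add: y_def distrib_left)
      hence "algebraic_int y" using algebraic_int_plus[OF td algebraic_int_cnj[OF td]] by simp
      moreover have "y \<in> \<rat>" unfolding y_def by (rule Rats_mult[OF Rats_of_int \<delta>'(3)])
      ultimately have "y \<in> \<int>" by (rule rational_algebraic_int_is_int)
      then obtain Y where Y: "y = of_int Y" by (auto elim: Ints_cases)
      \<comment> \<open>The triple angle formula: with \<delta>' on the unit circle, its trace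
        satisfies a cubic whose constant term is the trace of \<gamma>.\<close>
      have "(\<delta>' + cnj \<delta>') ^ 3 = \<delta>' ^ 3 + cnj \<delta>' ^ 3 + 3 * (\<delta>' * cnj \<delta>') * (\<delta>' + cnj \<delta>')"
        by (simp add: power3_eq_cube algebra_simps)
      hence "(\<delta>' + cnj \<delta>') ^ 3 - 3 * (\<delta>' + cnj \<delta>') = \<gamma> + cnj \<gamma>"
        using \<delta>'(1) by (simp add: d1 flip: complex_cnj_power)
      hence "of_int (t ^ 3) * ((\<delta>' + cnj \<delta>') ^ 3 - 3 * (\<delta>' + cnj \<delta>')) = of_int T"
        unfolding \<gamma>tr using tt by simp
      hence "y ^ 3 - 3 * of_int t ^ 2 * y = of_int T"
        by (simp add: y_def power_mult_distrib algebra_simps power2_eq_square power3_eq_cube)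
      hence "of_int (Y ^ 3 - 3 * t ^ 2 * Y) = (of_int T :: complex)" by (simp add: Y)
      hence "Y ^ 3 - 3 * t ^ 2 * Y = T" by (simp only: of_int_eq_iff)
      \<comment> \<open>With T = 7 - 2 t^3 the cubic y^3 - 3 t^2 y + 2 t^3 has the double root
        t.\<close>
      hence fac: "(Y - t) ^ 2 * (Y + 2 * t) = 7"
        by (simp add: T_def algebra_simps power2_eq_square power3_eq_cube)
      hence "Y - t = 1 \<or> Y - t = -1" by (rule unit_square_times)
      \<comment> \<open>The cases give 3 t + 1 = 7 or 3 t - 1 = 7, both impossible for t \<ge>
        14.\<close>
      thus False using fac \<open>t \<ge> 14\<close> by auto
    qed
  qed (rule \<theta>_ints \<theta>0 ints_closed(3))+
qed

end
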